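(* Let $q$ be a prime power, let $m$ be a positive integer and let $n_1,n_2\ge 2$ be two positive integers. The direct sum $$\mathcal U_{1,n_1}(q)\oplus\mathcal U_{1,n_2}(q)$$ is $\mathbb F_{q^m}$-representable if at least one of the following holds. (1) $m$ is even and $m\ge 2\max\{n_1,n_2\}$; (2) $m\ge n_1n_2$; (3) $m=t_1t_2$ for positive integers $t_1,t_2$ with $t_1\ge n_1$ and $n_2\le\frac{t_1(t_2-1)}{2}+1$; (4) $m=t_1t_2$ for positive integers $t_1,t_2$ with $t_1\ge n_1$, $t_1\ge n_2$ and $t_2\ge 2$; (5) $q=p^h$, $m=p^r$ for a prime $p$ and positive integers $h,r$, and $n_1+n_2-1\le\frac m2$.
   Context: For a finite-dimensional $\mathbb F_q$-vector space $E$ let $\mathcal L(E)$ be the lattice of its subspaces. A $q$-matroid with ground space $E$ is a pair $(E,\rho)$ with $\rho:\mathcal L(E)\to\mathbb Z$ satisfying, for all $A,B\in\mathcal L(E)$: $0\le\rho(A)\le\dim A$; $A\le B\Rightarrow\rho(A)\le\rho(B)$; $\rho(A+B)+\rho(A\cap B)\le\rho(A)+\rho(B)$. Its rank is $\rho(E)$. The uniform $q$-matroid $\mathcal U_{k,n}(q)$ is $(\mathbb F_q^n,\rho)$ with $\rho(V)=\min\{k,\dim V\}$. **Direct sum.** For $q$-matroids $\mathcal M_i=(E_i,\rho_i)$, $i=1,2$, let $E=E_1\oplus E_2$ with projections $\pi_i:E\to E_i$ and $\rho_i'(V)=\rho_i(\pi_i(V))$. Then $\mathcal M_1\oplus\mathcal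 M_2=(E,\rho)$ with $\rho(V)=\dim V+\min_{X\le V}(\rho_1'(X)+\rho_2'(X)-\dim X)$. Here $\mathbb F_q^{n_1}\oplus\mathbb F_q^{n_2}$ is identified with $\mathbb F_q^{n_1+n_2}$. **Representability.** For a matrix $G$ with $n$ columns and entries in $\mathbb F_{q^m}$, $\mathcal M_G=(\mathbb F_q^n,\rho)$ is the $q$-matroid with $\rho(U)=\mathrm{rk}(GA^U)$, where $A^U$ is a matrix whose columns form a basis of $U\le\mathbb F_q^n$. A $q$-matroid $\mathcal M$ with ground space $\mathbb F_q^n$ is $\mathbb F_{q^m}$-representable if $\mathcal M=\mathcal M_G$ for some such matrix $G$ whose rank equals the rank of $\mathcal M$. *)

theory Defs
  imports
    "HOL-Number_Theory.Prime_Powers"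
    "HOL-Library.Cardinality"
    "Jordan_Normal_Form.Ring_Hom_Matrix"
    "Jordan_Normal_Form.DL_Rank"
begin

text \<open>Subspaces of the coordinate space $K^n$ of column vectors, for an arbitrary finite field $K$
  given by the type variable.\<close>

abbreviation vsubspace :: "nat \<Rightarrow> 'a::field vec set \<Rightarrow> bool" where
  "vsubspace n W \<equiv> VectorSpace.subspace class_ring W (module_vec TYPE('a) n)"

abbreviation as_space :: "nat \<Rightarrow> 'a::field vec set \<Rightarrow> ('a, 'a vec) module" where
  "as_space n W \<equiv> module_vec TYPE('a) n\<lparr>carrier := W\<rparr>"

definition vsdim :: "nat \<Rightarrow> 'a::field vec set \<Rightarrow> nat" where
  "vsdim n W = vectorspace.dim class_ring (as_space n W)"

abbreviation vsum :: "nat \<Rightarrow> 'a::field vec set \<Rightarrow> 'a vec set \<Rightarrow> 'a vec set" where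
  "vsum n \<equiv> LinearCombinations.module.submodule_sum (module_vec TYPE('a) n)"

text \<open>A $q$-matroid with ground space $K^n$ is carried by its dimension \<open>n\<close> and its rank function.
  Only the values of the rank function on subspaces of $K^n$ are meaningful, so $q$-matroids are
  compared by \<open>qm_eq\<close> and not by equality of records.\<close>

record 'a qmatroid =
  ground_dim :: nat
  rk :: "'a vec set \<Rightarrow> int"

definition is_qmatroid :: "'a::{field,finite} qmatroid \<Rightarrow> bool" where
  "is_qmatroid M \<longleftrightarrow> (let n = ground_dim M; \<rho> = rk M in
     (\<forall>A. vsubspace n A \<longrightarrow> 0 \<le> \<rho> A \<and> \<rho> A \<le> int (vsdim n A)) \<and>
     (\<forall>A B. vsubspace n A \<longrightarrow> vsubspace n B \<longrightarrow> A \<subseteq> B \<longrightarrow> \<rho> A \<le> \<rho> B) \<and>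
     (\<forall>A B. vsubspace n A \<longrightarrow> vsubspace n B \<longrightarrow> \<rho> (vsum n A B) + \<rho> (A \<inter> B) \<le> \<rho> A + \<rho> B))"

definition qm_rank :: "'a::{field,finite} qmatroid \<Rightarrow> int" where
  "qm_rank M = rk M (carrier_vec (ground_dim M))"

definition qm_eq :: "'a::{field,finite} qmatroid \<Rightarrow> 'a qmatroid \<Rightarrow> bool" where
  "qm_eq M N \<longleftrightarrow> ground_dim M = ground_dim N \<and>
     (\<forall>U. vsubspace (ground_dim M) U \<longrightarrow> rk M U = rk N U)"

definition uniform_qmatroid :: "nat \<Rightarrow> nat \<Rightarrow> 'a::{field,finite} qmatroid" where
  "uniform_qmatroid k n = \<lparr>ground_dim = n, rk = (\<lambda>V. int (min k (vsdim n V)))\<rparr>"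

text \<open>$K^{n_1} \oplus K^{n_2}$ is identified with $K^{n_1+n_2}$; the two projections are then
  \<open>vec_first\<close> and \<open>vec_last\<close>. The minimum ranges over a finite set because $K$ is finite, and over
  a nonempty one because $X = V$ is allowed.\<close>

definition qm_direct_sum :: "'a::{field,finite} qmatroid \<Rightarrow> 'a qmatroid \<Rightarrow> 'a qmatroid" where
  "qm_direct_sum M\<^sub>1 M\<^sub>2 =
     (let n\<^sub>1 = ground_dim M\<^sub>1; n\<^sub>2 = ground_dim M\<^sub>2; n = n\<^sub>1 + n\<^sub>2;
          \<rho>\<^sub>1' = (\<lambda>X. rk M\<^sub>1 ((\<lambda>v. vec_first v n\<^sub>1) ` X));
          \<rho>\<^sub>2' = (\<lambda>X. rk M\<^sub>2 ((\<lambda>v. vec_last v n\<^sub>2) ` X))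
      in \<lparr>ground_dim = n,
          rk = (\<lambda>V. int (vsdim n V) +
                 (MIN X \<in> {X. vsubspace n X \<and> X \<subseteq> V}. \<rho>\<^sub>1' X + \<rho>\<^sub>2' X - int (vsdim n X)))\<rparr>)"

definition is_basis_matrix :: "nat \<Rightarrow> 'a::field vec set \<Rightarrow> 'a mat \<Rightarrow> bool" where
  "is_basis_matrix n U A \<longleftrightarrow> dim_row A = n \<and> distinct (cols A) \<and>
     vectorspace.basis class_ring (as_space n U) (set (cols A))"

text \<open>The inclusion of $\mathbb F_q$ into $\mathbb F_{q^m}$ is an explicit field homomorphism
  \<open>\<iota>\<close>, applied entrywise to $A^U$. The matrix $A^U$ is chosen by \<open>SOME\<close>: two choices differ by an
  invertible matrix on the right, so the rank does not depend on it.\<close>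

definition matrix_qmatroid :: "('a::{field,finite} \<Rightarrow> 'b::field) \<Rightarrow> 'b mat \<Rightarrow> 'a qmatroid" where
  "matrix_qmatroid \<iota> G =
     \<lparr>ground_dim = dim_col G,
      rk = (\<lambda>U. int (vec_space.rank (dim_row G)
                  (G * map_mat \<iota> (SOME A. is_basis_matrix (dim_col G) U A))))\<rparr>"

definition representable_via :: "('a::{field,finite} \<Rightarrow> 'b::field) \<Rightarrow> 'a qmatroid \<Rightarrow> bool" where
  "representable_via \<iota> M \<longleftrightarrow> is_qmatroid M \<and>
     (\<exists>k. \<exists>G \<in> carrier_mat k (ground_dim M).
        qm_eq M (matrix_qmatroid \<iota> G) \<and> int (vec_space.rank k G) = qm_rank M)"

lemma basis_matrix_exists:
  fixes U :: "'a::{field,finite} vec set"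
  assumes U: "vsubspace n U"
  shows "\<exists>A. is_basis_matrix n U A"
proof -
  interpret V: vec_space "TYPE('a)" n .
  have sub: "U \<subseteq> carrier_vec n"
    using subspace.submod[OF U] submodule.subset[of class_ring U V.V] by simp
  have "carrier_vec n \<subseteq> vec_of_list ` {xs :: 'a list. set xs \<subseteq> UNIV \<and> length xs = n}"
  proof
    fix v :: "'a vec" assume "v \<in> carrier_vec n"
    then have "v = vec_of_list (list_of_vec v)" "length (list_of_vec v) = n"
      by (auto simp: vec_list)
    then show "v \<in> vec_of_list ` {xs :: 'a list. set xs \<subseteq> UNIV \<and> length xs = n}" by blast
  qed
  then have "finite (carrier_vec n :: 'a vec set)"
    by (rule finite_subset) (intro finite_imageI finite_lists_length_eq finite)
  then have fin: "finite U" using sub finite_subset by blast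
  interpret W: vectorspace class_ring "as_space n U"
    using V.subspace_is_vs[OF U] .
  have "W.gen_set U"
    using W.in_own_span[of U] W.span_is_subset2[of U] by auto
  then have "W.fin_dim" unfolding W.fin_dim_def using fin by auto
  then obtain B where B: "finite B" "W.basis B" using W.finite_basis_exists by blast
  obtain bs where bs: "set bs = B" "distinct bs" using finite_distinct_list[OF B(1)] by blast
  have "set bs \<subseteq> carrier_vec n" using B(2) bs sub unfolding W.basis_def by auto
  then have "cols (mat_of_cols n bs) = bs" by simp
  then have "is_basis_matrix n U (mat_of_cols n bs)"
    unfolding is_basis_matrix_def using bs B by simp
  then show ?thesis by blast
qed

end

theory Submission
  imports Defs "HOL-Number_Theory.Residues"
begin

text \<open>Write $F = \mathbb F_q$, embedded in $K = \mathbb F_{q^m}$ by \<open>\<iota>\<close>, and let $E_1, E_2$ be the two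
summands of the ground space $F^{n_1+n_2}$. In the direct sum of two rank-one uniform
$q$-matroids the zero space has rank 0, a nonzero space has rank 1 if it is a line or lies
inside $E_1$ or $E_2$, and every other space has rank 2 (\<open>rk_direct_sum_uniform_one\<close>). That this is
a $q$-matroid follows from this description by inspection.

Consequently the block matrix with first row $(\alpha, 0)$ and second row $(0, \beta)$, where
$\alpha \in K^{n_1}$ and $\beta \in K^{n_2}$, represents the direct sum as soon as the entries of
$\alpha$ and those of $\beta$ are linearly independent over $F$ and two vectors
$(x, y), (x', y')$ of $\langle\alpha\rangle_F \times \langle\beta\rangle_F$ with all four
coordinates nonzero are parallel over $K$ only if they are parallel over $F$. The last condition says
that the sets of ratios of nonzero elements of $A = \langle\alpha\rangle_F$ and of
$B = \langle\beta\rangle_F$ meet only in $F$ (\<open>ratio_disjoint\<close>). So everything reduces to finding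
$F$-subspaces $A, B \subseteq K$ of dimensions $n_1, n_2$ with this property
(\<open>representable_if_ratio_disjoint_dims\<close>), and each arithmetic hypothesis supplies them in its own way.

If $m \ge n_1 n_2$, take a primitive element $\theta$ and let $A$ be spanned by
$\theta^i$ with $i < n_1$, and $B$ by $\theta^{n_1 j}$ with $j < n_2$. The products
$\theta^{i + n_1 j}$ are still independent, so a product $x y$ determines $x$ and $y$ up to
scalars of $F$ (\<open>ratio_disjoint_dims_product\<close>).

If $m = t_1 t_2$ and $n_1 \le t_1$, let $A$ be the intermediate field $L$ of degree $t_1$. Then $B$ has to be
scattered, that is, to meet each $L$-line in at most an $F$-line. A scattered subspace of dimension
$k$ can be enlarged whenever $2k + t_1 \le m$, because the vectors that spoil it lie in
$B + L\cdot B$, a set with fewer than $q^{2k+t_1}$ elements (\<open>scattered_subspace_extend\<close>).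

In the remaining cases one starts from $A$ and a Frobenius-stable $B_0$ whose products all lie in
an $F$-space $S$ with $\lvert S\rvert^2 \le \lvert K\rvert$. There is then $\gamma \in K$ with
$S \cap \gamma S = 0$, and $B = \{y + \gamma y^q \mid y \in B_0\}$ works: the equation
$x(y' + \gamma y'^q) = x'(y + \gamma y^q)$ splits into its two components, whence
$x/x' = y/y' = (y/y')^q$ is fixed by Frobenius (\<open>ratio_disjoint_dims_twist\<close>). If $m = t_1 t_2$ with
$t_2 \ge 2$ and $t_1 \ge n_1, n_2$, all of $A, B_0, S$ may be the intermediate field of degree $t_1$;
the case of even $m$ is $t_2 = 2$. If $m$ is a power of the characteristic, the Frobenius $\sigma$
is unipotent on $K$, and the kernels $V_k$ of $(\sigma - 1)^k$ form a complete flag of $\sigma$-stable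
subspaces which behave like polynomials of degree less than $k$: $V_i V_j \subseteq V_{i+j-1}$.
Then $A = V_{n_1}$, $B_0 = V_{n_2}$ and $S = V_{n_1+n_2-1}$ do
(\<open>ratio_disjoint_dims_unipotent\<close>).\<close>

section \<open>Counting in finite fields\<close>

lemma power_card_eq_same:
  fixes x :: "'b::{field,finite}"
  shows "x ^ CARD('b) = x"
proof (cases "x = 0")
  case False
  have card: "CARD('b) = Suc (card (UNIV - {0 :: 'b}))"
    by (simp add: card_Diff_singleton card_gt_0_iff)
  have "(\<Prod>y\<in>UNIV - {0}. y) = (\<Prod>y\<in>UNIV - {0}. x * y)"
    by (rule prod.reindex_bij_witness[of _ "\<lambda>y. x * y" "\<lambda>y. y / x"]) (use False in auto)
  also have "\<dots> = x ^ card (UNIV - {0 :: 'b}) * (\<Prod>y\<in>UNIV - {0}. y)"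
    by (simp add: prod.distrib)
  finally have "x ^ card (UNIV - {0 :: 'b}) = 1" by simp
  then show ?thesis by (simp only: card power_Suc mult_1_right)
qed (simp add: card_gt_0_iff)

lemma card_power_fixed_le:
  fixes N :: nat
  assumes "N \<ge> 2"
  shows "card {x :: 'b::field. x ^ N = x} \<le> N"
proof -
  define P :: "'b poly" where "P = Polynomial.monom 1 N - Polynomial.monom 1 1"
  have "Polynomial.coeff P N = 1" using assms by (simp add: P_def)
  then have "P \<noteq> 0" by auto
  have "card {x. poly P x = 0} \<le> degree P"
    by (rule card_poly_roots_bound) fact
  also have "degree P \<le> N"
    unfolding P_def using assms by (intro degree_diff_le) (auto simp: Polynomial.degree_monom_eq)
  finally show ?thesis by (simp add: P_def Polynomial.poly_monom)
qed

text \<open>Every nonempty fibre of \<open>f\<close> is a translate of a part of the kernel.\<close>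
lemma card_le_card_kernel_times_card_image:
  fixes f :: "'c::ab_group_add \<Rightarrow> 'd::ab_group_add"
  assumes "finite V" and diff: "\<And>x y. x \<in> V \<Longrightarrow> y \<in> V \<Longrightarrow> x - y \<in> V"
    and f: "\<And>x y. f (x - y) = f x - f y"
  shows "card V \<le> card {x \<in> V. f x = 0} * card (f ` V)"
proof -
  have fib: "card {x \<in> V. f x = z} \<le> card {x \<in> V. f x = 0}" if "z \<in> f ` V" for z
  proof -
    obtain x0 where x0: "x0 \<in> V" "z = f x0" using \<open>z \<in> f ` V\<close> by blast
    show ?thesis
      by (rule card_inj_on_le[of "\<lambda>x. x - x0"]) (use assms x0 in \<open>auto simp: inj_on_def f\<close>)
  qed
  have "card V = (\<Sum>z\<in>f ` V. card {x \<in> V. f x = z})"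
    using sum.image_gen[OF assms(1), of "\<lambda>_. 1::nat" f] by simp
  also have "\<dots> \<le> (\<Sum>z\<in>f ` V. card {x \<in> V. f x = 0})"
    by (intro sum_mono fib)
  finally show ?thesis by (simp add: mult.commute)
qed

section \<open>Subspaces of a finite extension field\<close>

locale finite_field_extension = field_hom \<iota> for \<iota> :: "'a::{field,finite} \<Rightarrow> 'b::{field,finite}" +
  fixes q m :: nat
  assumes card_base: "CARD('a) = q" and card_extension: "CARD('b) = q ^ m"
    and primepow_q: "primepow q"
begin

sublocale K: vector_space "\<lambda>c x. \<iota> c * x"
  by unfold_locales (auto simp: hom_distribs algebra_simps)

(* K.scale_scale turns a product of images into the image of a product, against hom_mult;
   together they do not terminate. *)
declare K.scale_scale [simp del]

lemma q_ge_2: "q \<ge> 2"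
  using primepow_gt_Suc_0[OF primepow_q] by simp

lemma prime_CHAR: "prime CHAR('b)"
  by (intro prime_CHAR_semidom finite_imp_CHAR_pos) simp

text \<open>This makes $x \mapsto x^q$ additive.\<close>
lemma card_eq_CHAR_power: "\<exists>h. q = CHAR('b) ^ h"
proof -
  obtain p h where p: "prime p" "q = p ^ h" "h > 0"
    using primepow_q by (auto simp: primepow_def)
  have char: "prime CHAR('a)"
    by (intro prime_CHAR_semidom finite_imp_CHAR_pos) simp
  have "CHAR('a) dvd p ^ h" using CHAR_dvd_CARD[where 'a='a] p card_base by simp
  then have "CHAR('a) dvd p" using char prime_dvd_power by blast
  then have "CHAR('a) = p" using char p(1) primes_dvd_imp_eq by blast
  moreover have "of_nat CHAR('a) = (0::'b)"
    using hom_of_nat[of "CHAR('a)"] by simp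
  then have "CHAR('b) dvd CHAR('a)" by (simp add: of_nat_eq_0_iff_char_dvd)
  then have "CHAR('b) = CHAR('a)"
    using char prime_CHAR primes_dvd_imp_eq by blast
  ultimately show ?thesis using p by auto
qed

lemma frobenius_add: "(x + y :: 'b) ^ (q ^ k) = x ^ (q ^ k) + y ^ (q ^ k)"
proof -
  obtain h where "q = CHAR('b) ^ h" using card_eq_CHAR_power by blast
  then have "q ^ k = CHAR('b) ^ (h * k)" by (simp add: power_mult)
  then show ?thesis by (rule freshmans_dream'[OF prime_CHAR])
qed

lemma frobenius_diff: "(x - y :: 'b) ^ (q ^ k) = x ^ (q ^ k) - y ^ (q ^ k)"
  using frobenius_add[of "x - y" y k] by (simp add: algebra_simps)

lemma frobenius_base: "\<iota> c ^ (q ^ k) = \<iota> c"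
proof (induction k)
  case (Suc k)
  have "\<iota> c ^ q = \<iota> c"
    unfolding hom_power[symmetric] card_base[symmetric] by (simp only: power_card_eq_same)
  then show ?case unfolding power_Suc power_mult by (simp only: Suc)
next
  case 0
  show ?case unfolding power_0 power_one_right ..
qed

text \<open>$F$ is the fixed field of the Frobenius: it is fixed pointwise, and $x^q - x$ has no more than
  $q = \lvert F\rvert$ roots.\<close>
lemma range_iota: "range \<iota> = {x. x ^ q = x}"
proof (rule card_subset_eq)
  have "\<iota> c ^ q = \<iota> c" for c
    using frobenius_base[of c 1] unfolding power_one_right .
  then show "range \<iota> \<subseteq> {x. x ^ q = x}" by blast
  then have "card (range \<iota>) \<le> card {x :: 'b. x ^ q = x}" by (intro card_mono) auto
  moreover have "card (range \<iota>) = q" unfolding card_base[symmetric] by (intro card_image injI) simp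
  ultimately show "card (range \<iota>) = card {x :: 'b. x ^ q = x}"
    using card_power_fixed_le[OF q_ge_2, where 'b='b] by simp
qed simp

definition independent_family :: "nat \<Rightarrow> (nat \<Rightarrow> 'b) \<Rightarrow> bool" where
  "independent_family n \<alpha> \<longleftrightarrow> (\<forall>c. (\<Sum>i<n. \<iota> (c i) * \<alpha> i) = 0 \<longrightarrow> (\<forall>i<n. c i = 0))"

definition family_span :: "nat \<Rightarrow> (nat \<Rightarrow> 'b) \<Rightarrow> 'b set" where
  "family_span n \<alpha> = range (\<lambda>c. \<Sum>i<n. \<iota> (c i) * \<alpha> i)"

lemma family_span_eq: "family_span n \<alpha> = (\<lambda>c. \<Sum>i<n. \<iota> (c i) * \<alpha> i) ` (Pi\<^sub>E {..<n} (\<lambda>_. UNIV))"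
proof -
  have "(\<Sum>i<n. \<iota> (c i) * \<alpha> i) \<in> (\<lambda>c. \<Sum>i<n. \<iota> (c i) * \<alpha> i) ` (Pi\<^sub>E {..<n} (\<lambda>_. UNIV))" for c
    by (rule image_eqI[of _ _ "restrict c {..<n}"]) simp_all
  then show ?thesis unfolding family_span_def by (intro equalityI subsetI) (elim rangeE imageE; simp)+
qed

lemma card_family_span_le: "card (family_span n \<alpha>) \<le> q ^ n"
proof -
  have "finite (Pi\<^sub>E {..<n} (\<lambda>_. UNIV :: 'a set))" by (simp add: finite_PiE)
  then have "card (family_span n \<alpha>) \<le> card (Pi\<^sub>E {..<n} (\<lambda>_. UNIV :: 'a set))"
    unfolding family_span_eq by (rule card_image_le)
  also have "\<dots> = q ^ n"
    by (simp only: card_funcsetE finite_lessThan card_lessThan card_base)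
  finally show ?thesis .
qed

lemma card_family_span:
  assumes "independent_family n \<alpha>"
  shows "card (family_span n \<alpha>) = q ^ n"
proof -
  have "inj_on (\<lambda>c. \<Sum>i<n. \<iota> (c i) * \<alpha> i) (Pi\<^sub>E {..<n} (\<lambda>_. UNIV))"
  proof (rule inj_onI)
    fix c d
    assume cd: "c \<in> Pi\<^sub>E {..<n} (\<lambda>_. UNIV)" "d \<in> Pi\<^sub>E {..<n} (\<lambda>_. UNIV)"
      "(\<Sum>i<n. \<iota> (c i) * \<alpha> i) = (\<Sum>i<n. \<iota> (d i) * \<alpha> i)"
    then have "(\<Sum>i<n. \<iota> (c i - d i) * \<alpha> i) = 0"
      by (simp add: hom_distribs left_diff_distrib sum_subtractf)
    then have "c i - d i = 0" if "i < n" for i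
      using assms[unfolded independent_family_def, THEN spec[of _ "\<lambda>i. c i - d i"]] that by blast
    then show "c = d" by (intro PiE_ext[OF cd(1,2)]) simp
  qed
  then show ?thesis unfolding family_span_eq by (simp only: card_image card_funcsetE finite_lessThan card_lessThan card_base)
qed

lemma subspace_family_span: "K.subspace (family_span n \<alpha>)"
proof (rule K.subspaceI)
  show "0 \<in> family_span n \<alpha>"
    unfolding family_span_def by (intro image_eqI[of _ _ "\<lambda>_. 0"]) auto
next
  fix x y assume "x \<in> family_span n \<alpha>" "y \<in> family_span n \<alpha>"
  then obtain c d where "x = (\<Sum>i<n. \<iota> (c i) * \<alpha> i)" "y = (\<Sum>i<n. \<iota> (d i) * \<alpha> i)"
    unfolding family_span_def by blast
  then have "x + y = (\<Sum>i<n. \<iota> (c i + d i) * \<alpha> i)"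
    by (simp add: hom_distribs distrib_right sum.distrib)
  then show "x + y \<in> family_span n \<alpha>"
    unfolding family_span_def by (rule range_eqI[of _ _ "\<lambda>i. c i + d i"])
next
  fix a x assume "x \<in> family_span n \<alpha>"
  then obtain c where "x = (\<Sum>i<n. \<iota> (c i) * \<alpha> i)" unfolding family_span_def by blast
  then have "\<iota> a * x = (\<Sum>i<n. \<iota> (a * c i) * \<alpha> i)"
    by (simp add: hom_mult sum_distrib_left mult.assoc)
  then show "\<iota> a * x \<in> family_span n \<alpha>"
    unfolding family_span_def by (rule range_eqI[of _ _ "\<lambda>i. a * c i"])
qed

lemma family_span_subset:
  assumes "K.subspace V" "\<And>i. i < n \<Longrightarrow> \<alpha> i \<in> V"
  shows "family_span n \<alpha> \<subseteq> V"
  using assms unfolding family_span_def by (auto intro!: K.subspace_sum K.subspace_scale)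

text \<open>Dimensions are bounded from below by cardinalities throughout: a set with at least $q^n$ elements is
  not exhausted by the span of fewer than $n$ of them, so independent elements can be picked
  one after the other.\<close>
lemma independent_family_exists:
  assumes "q ^ n \<le> card V"
  shows "\<exists>\<alpha>. independent_family n \<alpha> \<and> (\<forall>i<n. \<alpha> i \<in> V)"
  using assms
proof (induction n)
  case 0
  then show ?case by (auto simp: independent_family_def)
next
  case (Suc k)
  have lt: "q ^ k < q ^ Suc k" using q_ge_2 by simp
  then obtain \<alpha> where \<alpha>: "independent_family k \<alpha>" "\<forall>i<k. \<alpha> i \<in> V"
    using Suc by (meson less_imp_le order.trans)
  have "\<not> V \<subseteq> family_span k \<alpha>"
    using card_mono[of "family_span k \<alpha>" V] card_family_span_le[of k \<alpha>] lt Suc.prems by force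
  then obtain a where a: "a \<in> V" "a \<notin> family_span k \<alpha>" by blast
  let ?\<beta> = "\<alpha>(k := a)"
  have "independent_family (Suc k) ?\<beta>"
    unfolding independent_family_def
  proof (intro allI impI)
    fix c i assume "(\<Sum>i<Suc k. \<iota> (c i) * ?\<beta> i) = 0" and i: "i < Suc k"
    then have eq: "(\<Sum>i<k. \<iota> (c i) * \<alpha> i) + \<iota> (c k) * a = 0" by simp
    have ck: "c k = 0"
    proof (rule ccontr)
      assume "c k \<noteq> 0"
      from eq have "\<iota> (c k) * a = - (\<Sum>i<k. \<iota> (c i) * \<alpha> i)"
        by (simp add: eq_neg_iff_add_eq_0 add.commute)
      moreover have "a = \<iota> (- inverse (c k)) * z" if "\<iota> (c k) * a = - z" for z
        using that \<open>c k \<noteq> 0\<close> by (simp add: hom_distribs field_simps)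
      ultimately have "a = \<iota> (- inverse (c k)) * (\<Sum>i<k. \<iota> (c i) * \<alpha> i)" by blast
      moreover have "(\<Sum>i<k. \<iota> (c i) * \<alpha> i) \<in> family_span k \<alpha>"
        unfolding family_span_def by blast
      ultimately show False using a subspace_family_span K.subspace_scale by metis
    qed
    with eq \<alpha>(1) have "\<forall>i<k. c i = 0" unfolding independent_family_def by simp
    with ck i show "c i = 0" using less_Suc_eq by auto
  qed
  moreover have "\<forall>i<Suc k. ?\<beta> i \<in> V" using \<alpha>(2) a(1) by simp
  ultimately show ?case by blast
qed

section \<open>Pairs of subspaces with few common ratios\<close>

text \<open>The sets of ratios $x/x'$ of $A$ and $y/y'$ of $B$ have only elements of $F$ in common.
  The equality of ratios is written without division, as the vanishing of a $2 \times 2$ minor.\<close>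

definition ratio_disjoint :: "'b set \<Rightarrow> 'b set \<Rightarrow> bool" where
  "ratio_disjoint A B \<longleftrightarrow> (\<forall>x\<in>A. \<forall>x'\<in>A. \<forall>y\<in>B. \<forall>y'\<in>B. x \<noteq> 0 \<longrightarrow> x' \<noteq> 0 \<longrightarrow> y \<noteq> 0 \<longrightarrow> y' \<noteq> 0 \<longrightarrow>
     x * y' = x' * y \<longrightarrow> x / x' \<in> range \<iota>)"

text \<open>The dimensions are only bounded below, since the ratio condition passes to subspaces.\<close>
definition ratio_disjoint_dims :: "nat \<Rightarrow> nat \<Rightarrow> bool" where
  "ratio_disjoint_dims n1 n2 \<longleftrightarrow> (\<exists>A B. K.subspace A \<and> K.subspace B \<and> q ^ n1 \<le> card A \<and>
     q ^ n2 \<le> card B \<and> ratio_disjoint A B)"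

text \<open>Since $S$ has at most $\lvert K\rvert$ pairs of elements and all pairs $(0, s)$ give the ratio 0, some
  $\gamma$ is not a ratio of elements of $S$, which means that $S + \gamma S$ is a direct sum. An
  equation between products of $A$ with elements $y + \gamma y^q$ can then be read componentwise, and the
  second component forces the common ratio to be fixed by Frobenius. The element \<open>a\<close> excludes
  $A = 0$, for which $S$ would say nothing about $B$.\<close>
lemma ratio_disjoint_dims_twist:
  assumes A: "K.subspace A" "q ^ n1 \<le> card A" "a \<in> A" "a \<noteq> 0"
    and B: "K.subspace B" "q ^ n2 \<le> card B" "\<And>y. y \<in> B \<Longrightarrow> y ^ q \<in> B"
    and S: "K.subspace S" "(card S)\<^sup>2 \<le> CARD('b)"
    and AB: "\<And>x y. x \<in> A \<Longrightarrow> y \<in> B \<Longrightarrow> x * y \<in> S"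
  shows "ratio_disjoint_dims n1 n2"
proof -
  let ?f = "\<lambda>(s, s'). s / s' :: 'b"
  have "\<exists>\<gamma>. \<forall>s\<in>S. \<forall>s'\<in>S. s = \<gamma> * s' \<longrightarrow> s = 0 \<and> s' = 0"
  proof (cases "S = {0}")
    case False
    with K.subspace_0[OF S(1)] obtain s where s: "s \<in> S" "s \<noteq> 0" by blast
    have "\<not> inj_on ?f (S \<times> S)"
      unfolding inj_on_def using s K.subspace_0[OF S(1)] by force
    then have "card (?f ` (S \<times> S)) < card (S \<times> S)"
      using card_image_le[of "S \<times> S" ?f] eq_card_imp_inj_on[of "S \<times> S" ?f] by force
    also have "\<dots> \<le> CARD('b)" using S(2) by (simp add: card_cartesian_product power2_eq_square)
    finally have "?f ` (S \<times> S) \<noteq> UNIV" by auto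
    then obtain \<gamma> where \<gamma>: "\<gamma> \<notin> ?f ` (S \<times> S)" by blast
    have "s = 0 \<and> s' = 0" if "s \<in> S" "s' \<in> S" "s = \<gamma> * s'" for s s'
    proof (cases "s' = 0")
      case False
      with that have "\<gamma> = ?f (s, s')" by simp
      with \<gamma> that show ?thesis by blast
    qed (use that in simp)
    then show ?thesis by blast
  qed auto
  then obtain \<gamma> where \<gamma>: "s = 0 \<and> s' = 0" if "s \<in> S" "s' \<in> S" "s = \<gamma> * s'" for s s'
    by blast
  define h where "h = (\<lambda>y. y + \<gamma> * y ^ q)"
  have h_add: "h (y + z) = h y + h z" for y z
    using frobenius_add[of y z 1] by (simp add: h_def algebra_simps)
  have h_scale: "h (\<iota> c * y) = \<iota> c * h y" for c y
    using frobenius_base[of c 1] by (simp add: h_def power_mult_distrib algebra_simps)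
  have h_eqD: "x * y' = x' * y \<and> x * y' ^ q = x' * y ^ q"
    if "x * h y' = x' * h y" "x \<in> A" "x' \<in> A" "y \<in> B" "y' \<in> B" for x x' y y'
  proof -
    have "x * y' - x' * y = \<gamma> * (x' * y ^ q - x * y' ^ q)"
      using that(1) by (simp add: h_def algebra_simps)
    moreover have "x * y' - x' * y \<in> S" "x' * y ^ q - x * y' ^ q \<in> S"
      using that AB B(3) by (auto intro!: K.subspace_diff[OF S(1)])
    ultimately show ?thesis using \<gamma> by fastforce
  qed
  have inj: "inj_on h B"
  proof (rule inj_onI)
    fix y y' assume "y \<in> B" "y' \<in> B" "h y = h y'"
    then show "y = y'" using h_eqD[of a y a y'] A by auto
  qed
  have "K.subspace (h ` B)"
  proof (rule K.subspaceI)
    have "h 0 = 0" using q_ge_2 by (simp add: h_def)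
    then show "0 \<in> h ` B" using K.subspace_0[OF B(1)] by (metis imageI)
  qed (use B(1) in \<open>auto simp: h_add[symmetric] h_scale[symmetric] K.subspace_add K.subspace_scale\<close>)
  moreover have "ratio_disjoint A (h ` B)"
    unfolding ratio_disjoint_def
  proof (intro ballI impI, elim imageE, hypsubst)
    fix x x' y y'
    assume xy: "x \<in> A" "x' \<in> A" "y \<in> B" "y' \<in> B" "x \<noteq> 0" "x' \<noteq> 0" "h y \<noteq> 0" "h y' \<noteq> 0"
      and eq: "x * h y' = x' * h y"
    have nz: "y \<noteq> 0" "y' \<noteq> 0" using xy q_ge_2 by (auto simp: h_def)
    have 1: "x * y' = x' * y" "x * y' ^ q = x' * y ^ q" using h_eqD[OF eq] xy by auto
    then have "x / x' = y / y'" "x / x' = (y / y') ^ q"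
      using nz xy by (simp_all add: field_simps)
    then have "(x / x') ^ q = x / x'" by simp
    then show "x / x' \<in> range \<iota>" unfolding range_iota by simp
  qed
  ultimately show ?thesis
    unfolding ratio_disjoint_dims_def using A B card_image[OF inj] by metis
qed

section \<open>Intermediate fields\<close>

text \<open>The subfield of degree $t$ over $F$ when $t$ divides $m$; in general its degree is the greatest common
  divisor of $t$ and $m$.\<close>

definition intermediate_field :: "nat \<Rightarrow> 'b set" where
  "intermediate_field t = {x. x ^ (q ^ t) = x}"

lemma subspace_intermediate_field: "K.subspace (intermediate_field t)"
  unfolding intermediate_field_def
proof (rule K.subspaceI)
  show "0 \<in> {x :: 'b. x ^ (q ^ t) = x}" using q_ge_2 by simp
qed (auto simp: frobenius_add power_mult_distrib frobenius_base)

lemma intermediate_field_mult: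
  "x \<in> intermediate_field t \<Longrightarrow> y \<in> intermediate_field t \<Longrightarrow> x * y \<in> intermediate_field t"
  by (simp add: intermediate_field_def power_mult_distrib)

lemma intermediate_field_divide:
  "x \<in> intermediate_field t \<Longrightarrow> y \<in> intermediate_field t \<Longrightarrow> x / y \<in> intermediate_field t"
  by (simp add: intermediate_field_def power_divide)

lemma base_in_intermediate_field: "\<iota> c \<in> intermediate_field t"
  by (simp add: intermediate_field_def frobenius_base)

lemma frobenius_intermediate_field:
  "x \<in> intermediate_field t \<Longrightarrow> x ^ q \<in> intermediate_field t"
  unfolding intermediate_field_def mem_Collect_eq by (metis power_mult mult.commute)

lemma card_intermediate_field_le:
  assumes "t > 0"
  shows "card (intermediate_field t) \<le> q ^ t"
  unfolding intermediate_field_def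
proof (rule card_power_fixed_le)
  show "q ^ t \<ge> 2" using q_ge_2 self_le_power[of q t] assms by linarith
qed

text \<open>With $Q = q^t$, the additive map $f(x) = x^Q - x$ has the intermediate field as its kernel. Its image
  is annihilated by the relative trace $\sum_{j<s} y^{Q^j}$, because the composition telescopes to
  $x^{Q^s} - x = 0$. A polynomial of degree $Q^{s-1}$ has at most that many roots, which leaves at
  least $Q$ elements for the kernel.\<close>
lemma card_intermediate_field_ge:
  assumes "m = t * s" "t > 0" "s > 0"
  shows "q ^ t \<le> card (intermediate_field t)"
proof -
  define Q where "Q = q ^ t"
  have Q2: "Q \<ge> 2" using q_ge_2 self_le_power[of q t] assms unfolding Q_def by linarith
  have cardB: "CARD('b) = Q ^ s" by (simp add: card_extension assms(1) Q_def power_mult)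
  define f where "f = (\<lambda>x :: 'b. x ^ Q - x)"
  define P :: "'b poly" where "P = (\<Sum>j<s. Polynomial.monom 1 (Q ^ j))"
  have Qj: "Q ^ j = q ^ (t * j)" for j by (simp add: Q_def power_mult)
  have f_diff: "f (x - y) = f x - f y" for x y
    unfolding f_def Q_def by (simp add: frobenius_diff)
  have "poly P (f x) = 0" for x
  proof -
    have "poly P (f x) = (\<Sum>j<s. (f x) ^ (Q ^ j))"
      by (simp add: P_def poly_sum Polynomial.poly_monom)
    also have "\<dots> = (\<Sum>j<s. x ^ (Q ^ Suc j) - x ^ (Q ^ j))"
      unfolding f_def by (simp add: Qj frobenius_diff flip: power_mult)
    also have "\<dots> = x ^ (Q ^ s) - x ^ (Q ^ 0)"
      by (rule sum_lessThan_telescope)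
    also have "\<dots> = 0" using power_card_eq_same[of x] by (simp add: cardB)
    finally show ?thesis .
  qed
  then have sub: "range f \<subseteq> {y. poly P y = 0}" by blast
  have "Polynomial.coeff P (Q ^ j) = 1" if "j < s" for j
  proof -
    have "Polynomial.coeff P (Q ^ j) = (\<Sum>i<s. if i = j then 1 else 0)"
      unfolding P_def coeff_sum using Q2 by (intro sum.cong) auto
    then show ?thesis using that by simp
  qed
  then have "Polynomial.coeff P (Q ^ 0) = 1" using assms(3) by blast
  then have "P \<noteq> 0" by auto
  then have "card {y. poly P y = 0} \<le> degree P" by (rule card_poly_roots_bound)
  also have "degree P \<le> Q ^ (s - 1)"
    unfolding P_def using Q2
    by (intro degree_sum_le) (auto simp: Polynomial.degree_monom_eq intro!: power_increasing)
  finally have img: "card (range f) \<le> Q ^ (s - 1)"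
    using card_mono[OF _ sub] by (meson finite order.trans)
  have "Q * Q ^ (s - 1) = CARD('b)" using cardB assms(3) by (simp flip: power_Suc)
  also have "\<dots> \<le> card {x. f x = 0} * card (range f)"
    using card_le_card_kernel_times_card_image[of UNIV f] f_diff by simp
  also have "\<dots> \<le> card {x. f x = 0} * Q ^ (s - 1)" by (intro mult_left_mono img) simp
  finally have "Q \<le> card {x. f x = 0}" using Q2 by simp
  then show ?thesis by (simp add: f_def Q_def intermediate_field_def)
qed

text \<open>The twisting construction with the intermediate field in all three roles.\<close>
lemma ratio_disjoint_dims_intermediate:
  assumes "m = t * s" "s \<ge> 2" "n1 \<le> t" "n2 \<le> t" "t > 0"
  shows "ratio_disjoint_dims n1 n2"
proof (rule ratio_disjoint_dims_twist)
  let ?L = "intermediate_field t"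
  show "K.subspace ?L" "K.subspace ?L" "K.subspace ?L" by (rule subspace_intermediate_field)+
  have card: "q ^ t \<le> card ?L" using card_intermediate_field_ge[of t s] assms by simp
  have mono: "q ^ n \<le> q ^ t" if "n \<le> t" for n
    using that q_ge_2 by (intro power_increasing) auto
  show "q ^ n1 \<le> card ?L" "q ^ n2 \<le> card ?L"
    using card mono assms(3,4) order.trans by blast+
  show "1 \<in> ?L" "(1 :: 'b) \<noteq> 0" using base_in_intermediate_field[of 1 t] by simp_all
  have "(card ?L)\<^sup>2 \<le> (q ^ t)\<^sup>2"
    using card_intermediate_field_le assms(5) by (intro power_mono) simp_all
  also have "\<dots> \<le> q ^ m"
    unfolding assms(1) power_mult[symmetric] using assms(2) q_ge_2 by (intro power_increasing) auto
  finally show "(card ?L)\<^sup>2 \<le> CARD('b)" by (simp add: card_extension)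
qed (auto intro: intermediate_field_mult frobenius_intermediate_field)

section \<open>Extensions whose degree is a power of the characteristic\<close>

text \<open>The binomial theorem for $(\sigma^j - 1)^k$, where $\sigma$ is the Frobenius. The coefficients lie in the
  prime field, so $\sigma$ passes over them.\<close>

lemma funpow_frobenius_minus_id:
  "((\<lambda>x. x ^ (q ^ j) - x) ^^ k) x =
     (\<Sum>i\<le>k. (- 1) ^ (k + i) * of_nat (k choose i) * (x :: 'b) ^ (q ^ (j * i)))"
proof (induction k)
  case (Suc k)
  define a where "a = (\<lambda>k i. (- 1) ^ (k + i) * of_nat (k choose i) :: 'a)"
  define y where "y = (\<lambda>i. x ^ (q ^ (j * i)))"
  have y_Suc: "y i ^ (q ^ j) = y (Suc i)" for i
    unfolding y_def by (simp add: ac_simps flip: power_mult power_add)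
  have iota_a: "\<iota> (a k i) = (- 1) ^ (k + i) * of_nat (k choose i)" for k i
    by (simp add: a_def hom_distribs)
  have a_rec: "a (Suc k) (Suc i) = a k i - a k (Suc i)" for i
    by (simp add: a_def algebra_simps)
  obtain h where h: "q = CHAR('b) ^ h" using card_eq_CHAR_power by blast
  have "q ^ j = CHAR('b) ^ (h * j)" by (simp add: h power_mult)
  note sum_pow = freshmans_dream_sum'[OF prime_CHAR this]
  have IH: "((\<lambda>x. x ^ (q ^ j) - x) ^^ k) x = (\<Sum>i\<le>k. \<iota> (a k i) * y i)"
    using Suc by (simp add: iota_a y_def)
  have low: "(\<Sum>i\<le>k. \<iota> (a k i) * y i) = \<iota> (a k 0) * y 0 + (\<Sum>i\<le>k. \<iota> (a k (Suc i)) * y (Suc i))"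
  proof -
    have "(\<Sum>i\<le>k. \<iota> (a k i) * y i) = (\<Sum>i\<le>Suc k. \<iota> (a k i) * y i)"
      by (simp add: a_def binomial_eq_0)
    then show ?thesis by (simp only: sum.atMost_Suc_shift)
  qed
  have "((\<lambda>x. x ^ (q ^ j) - x) ^^ Suc k) x
      = (\<Sum>i\<le>k. \<iota> (a k i) * y i) ^ (q ^ j) - (\<Sum>i\<le>k. \<iota> (a k i) * y i)"
    by (simp add: IH)
  also have "(\<Sum>i\<le>k. \<iota> (a k i) * y i) ^ (q ^ j) = (\<Sum>i\<le>k. \<iota> (a k i) * y (Suc i))"
    by (simp only: sum_pow power_mult_distrib frobenius_base y_Suc)
  also have "\<dots> - (\<Sum>i\<le>k. \<iota> (a k i) * y i)
      = \<iota> (a (Suc k) 0) * y 0 + (\<Sum>i\<le>k. \<iota> (a (Suc k) (Suc i)) * y (Suc i))"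
    unfolding low by (simp add: a_rec hom_distribs left_diff_distrib sum_subtractf) (simp add: a_def hom_distribs)
  also have "\<dots> = (\<Sum>i\<le>Suc k. \<iota> (a (Suc k) i) * y i)"
    by (simp only: sum.atMost_Suc_shift)
  finally show ?case unfolding iota_a y_def .
qed simp

text \<open>In characteristic $p$ the inner binomial coefficients vanish: $(\sigma^j - 1)^p = \sigma^{jp} - 1$.\<close>
lemma funpow_CHAR_frobenius_minus_id:
  "((\<lambda>x. x ^ (q ^ j) - x) ^^ CHAR('b)) x = (x :: 'b) ^ (q ^ (j * CHAR('b))) - x"
proof -
  let ?p = "CHAR('b)"
  let ?t = "\<lambda>i. (- 1) ^ (?p + i) * of_nat (?p choose i) * x ^ (q ^ (j * i))"
  have "(1 + (- 1) :: 'b) ^ ?p = 1 ^ ?p + (- 1) ^ ?p"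
    by (rule freshmans_dream) (use prime_CHAR in auto)
  then have sign: "(- 1 :: 'b) ^ ?p = - 1"
    using prime_gt_0_nat[OF prime_CHAR] by (simp add: power_0_left eq_neg_iff_add_eq_0 add.commute)
  have "?t i = 0" if "i \<in> {..?p} - {0, ?p}" for i
  proof -
    have "?p dvd (?p choose i)"
      using that prime_CHAR by (intro dvd_choose_prime) auto
    then have "of_nat (?p choose i) = (0 :: 'b)" by (simp add: of_nat_eq_0_iff_char_dvd)
    then show ?thesis by simp
  qed
  then have "(\<Sum>i\<le>?p. ?t i) = (\<Sum>i\<in>{0, ?p}. ?t i)"
    by (intro sum.mono_neutral_right) auto
  also have "\<dots> = ?t 0 + ?t ?p" using prime_gt_0_nat[OF prime_CHAR] by simp
  also have "\<dots> = x ^ (q ^ (j * ?p)) - x" by (simp add: sign power_add)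
  finally show ?thesis unfolding funpow_frobenius_minus_id .
qed

lemma funpow_CHAR_power_frobenius_minus_id:
  "((\<lambda>x. x ^ q - x) ^^ (CHAR('b) ^ r)) = (\<lambda>x :: 'b. x ^ (q ^ (CHAR('b) ^ r)) - x)"
proof (induction r)
  case (Suc r)
  have "((\<lambda>x. x ^ q - x) ^^ (CHAR('b) ^ Suc r)) = (((\<lambda>x :: 'b. x ^ q - x) ^^ (CHAR('b) ^ r)) ^^ CHAR('b))"
    by (simp add: funpow_mult mult.commute)
  also have "\<dots> = (\<lambda>x. x ^ (q ^ (CHAR('b) ^ Suc r)) - x)"
    unfolding Suc by (simp add: fun_eq_iff funpow_CHAR_frobenius_minus_id mult.commute)
  finally show ?case .
qed simp

text \<open>The kernel of $(\sigma - 1)^k$. The operator $\sigma - 1$ acts on it like a difference operator on polynomials of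
  degree less than $k$.\<close>
definition unipotent_kernel :: "nat \<Rightarrow> 'b set" where
  "unipotent_kernel k = {x. ((\<lambda>x. x ^ q - x) ^^ k) x = 0}"

lemma unipotent_kernel_0: "unipotent_kernel 0 = {0}"
  by (simp add: unipotent_kernel_def)

lemma unipotent_kernel_Suc: "x \<in> unipotent_kernel (Suc k) \<longleftrightarrow> x ^ q - x \<in> unipotent_kernel k"
  by (simp add: unipotent_kernel_def funpow_Suc_right del: funpow.simps)

lemma subspace_unipotent_kernel: "K.subspace (unipotent_kernel k)"
proof (induction k)
  case 0
  then show ?case by (simp add: unipotent_kernel_0 K.subspace_def)
next
  case (Suc k)
  show ?case
  proof (rule K.subspaceI)
    show "0 \<in> unipotent_kernel (Suc k)"
      using K.subspace_0[OF Suc] q_ge_2 by (simp add: unipotent_kernel_Suc power_0_left)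
  next
    fix x y assume "x \<in> unipotent_kernel (Suc k)" "y \<in> unipotent_kernel (Suc k)"
    then have "(x ^ q - x) + (y ^ q - y) \<in> unipotent_kernel k"
      unfolding unipotent_kernel_Suc by (rule K.subspace_add[OF Suc])
    then show "x + y \<in> unipotent_kernel (Suc k)"
      using frobenius_add[of x y 1] by (simp add: unipotent_kernel_Suc algebra_simps)
  next
    fix c x assume "x \<in> unipotent_kernel (Suc k)"
    then have "\<iota> c * (x ^ q - x) \<in> unipotent_kernel k"
      unfolding unipotent_kernel_Suc by (rule K.subspace_scale[OF Suc])
    then show "\<iota> c * x \<in> unipotent_kernel (Suc k)"
      using frobenius_base[of c 1]
      by (simp add: unipotent_kernel_Suc power_mult_distrib right_diff_distrib)
  qed
qed

lemma unipotent_kernel_mono: "unipotent_kernel k \<subseteq> unipotent_kernel (Suc k)"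
  using q_ge_2 by (auto simp: unipotent_kernel_def)

lemma frobenius_unipotent_kernel: "x \<in> unipotent_kernel k \<Longrightarrow> x ^ q \<in> unipotent_kernel k"
proof -
  assume x: "x \<in> unipotent_kernel k"
  then have "x ^ q - x \<in> unipotent_kernel k"
    using unipotent_kernel_mono unipotent_kernel_Suc by blast
  from K.subspace_add[OF subspace_unipotent_kernel this x] show ?thesis by simp
qed

text \<open>The analogue of adding degrees, from the twisted Leibniz rule
  $(\sigma - 1)(xy) = (\sigma - 1)(x)\,\sigma(y) + x\,(\sigma - 1)(y)$.\<close>
lemma unipotent_kernel_mult:
  "x \<in> unipotent_kernel (Suc i) \<Longrightarrow> y \<in> unipotent_kernel (Suc j) \<Longrightarrow>
     x * y \<in> unipotent_kernel (Suc (i + j))"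
proof (induction "i + j" arbitrary: i j x y rule: less_induct)
  case less
  have split: "(x * y) ^ q - x * y = (x ^ q - x) * y ^ q + x * (y ^ q - y)"
    by (simp add: power_mult_distrib algebra_simps)
  have "(x ^ q - x) * y ^ q \<in> unipotent_kernel (i + j)"
  proof (cases i)
    case 0
    then have "x ^ q - x = 0" using less.prems(1) by (simp add: unipotent_kernel_Suc unipotent_kernel_0)
    then show ?thesis using K.subspace_0[OF subspace_unipotent_kernel] by simp
  next
    case (Suc i')
    then show ?thesis
      using less.hyps[of i' j "x ^ q - x" "y ^ q"] less.prems frobenius_unipotent_kernel[OF less.prems(2)]
      by (simp add: unipotent_kernel_Suc)
  qed
  moreover have "x * (y ^ q - y) \<in> unipotent_kernel (i + j)"
  proof (cases j)
    case 0
    then have "y ^ q - y = 0" using less.prems(2) by (simp add: unipotent_kernel_Suc unipotent_kernel_0)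
    then show ?thesis using K.subspace_0[OF subspace_unipotent_kernel] by simp
  next
    case (Suc j')
    then show ?thesis
      using less.hyps[of i j' x "y ^ q - y"] less.prems by (simp add: unipotent_kernel_Suc)
  qed
  ultimately show ?case
    unfolding unipotent_kernel_Suc[of "x * y"] split
    by (rule K.subspace_add[OF subspace_unipotent_kernel])
qed

lemma card_unipotent_kernel_Suc_le: "card (unipotent_kernel (Suc k)) \<le> q * card (unipotent_kernel k)"
proof -
  let ?V = "unipotent_kernel (Suc k)" and ?f = "\<lambda>x :: 'b. x ^ q - x"
  have "card ?V \<le> card {x \<in> ?V. ?f x = 0} * card (?f ` ?V)"
    using frobenius_diff[of _ _ 1]
    by (intro card_le_card_kernel_times_card_image K.subspace_diff[OF subspace_unipotent_kernel]) simp_all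
  also have "\<dots> \<le> q * card (unipotent_kernel k)"
  proof (rule mult_mono)
    have "card {x \<in> ?V. ?f x = 0} \<le> card {x :: 'b. x ^ q = x}" by (rule card_mono) auto
    then show "card {x \<in> ?V. ?f x = 0} \<le> q"
      using card_power_fixed_le[OF q_ge_2, where 'b='b] by simp
    show "card (?f ` ?V) \<le> card (unipotent_kernel k)"
      by (rule card_mono) (auto simp: unipotent_kernel_Suc)
  qed simp_all
  finally show ?thesis .
qed

lemma card_unipotent_kernel_add_le: "card (unipotent_kernel (k + l)) \<le> q ^ l * card (unipotent_kernel k)"
proof (induction l)
  case (Suc l)
  have "card (unipotent_kernel (k + Suc l)) \<le> q * card (unipotent_kernel (k + l))"
    using card_unipotent_kernel_Suc_le by simp
  also have "\<dots> \<le> q * (q ^ l * card (unipotent_kernel k))" using Suc by simp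
  finally show ?case by (simp add: mult.assoc)
qed simp

text \<open>Each step of the flag multiplies the cardinality by at most $q$, because $\sigma - 1$ maps the larger kernel
  into the smaller one and has only $F$ in its own kernel. As $(\sigma - 1)^m = \sigma^m - 1 = 0$, the flag
  reaches all $q^m$ elements of $K$ after $m$ steps, so no step can fall short.\<close>
lemma card_unipotent_kernel:
  assumes "m = CHAR('b) ^ r" "k \<le> m"
  shows "card (unipotent_kernel k) = q ^ k"
proof (rule antisym)
  show "card (unipotent_kernel k) \<le> q ^ k"
    using card_unipotent_kernel_add_le[of 0 k] by (simp add: unipotent_kernel_0)
  have "x ^ (q ^ m) = x" for x :: 'b
    using power_card_eq_same[of x] by (simp add: card_extension)
  then have "unipotent_kernel m = UNIV"
    using funpow_CHAR_power_frobenius_minus_id[of r] by (simp add: unipotent_kernel_def assms(1))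
  then have "q ^ m = card (unipotent_kernel (k + (m - k)))"
    using assms(2) by (simp add: card_extension)
  also have "\<dots> \<le> q ^ (m - k) * card (unipotent_kernel k)"
    by (rule card_unipotent_kernel_add_le)
  finally have "q ^ (m - k) * q ^ k \<le> q ^ (m - k) * card (unipotent_kernel k)"
    using assms(2) by (simp flip: power_add)
  then show "q ^ k \<le> card (unipotent_kernel k)" using q_ge_2 by simp
qed

lemma ratio_disjoint_dims_unipotent:
  assumes "m = CHAR('b) ^ r" "n1 \<ge> 1" "n2 \<ge> 1" "2 * (n1 + n2 - 1) \<le> m"
  shows "ratio_disjoint_dims n1 n2"
proof (rule ratio_disjoint_dims_twist)
  let ?V = unipotent_kernel
  obtain i j where ij: "n1 = Suc i" "n2 = Suc j"
    using assms(2,3) by (metis Suc_le_D One_nat_def)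
  show "K.subspace (?V n1)" "K.subspace (?V n2)" "K.subspace (?V (n1 + n2 - 1))"
    by (rule subspace_unipotent_kernel)+
  show "q ^ n1 \<le> card (?V n1)" "q ^ n2 \<le> card (?V n2)"
    using card_unipotent_kernel[OF assms(1)] assms(2-4) by simp_all
  show "1 \<in> ?V n1" "(1 :: 'b) \<noteq> 0"
    using K.subspace_0[OF subspace_unipotent_kernel] by (simp_all add: ij unipotent_kernel_Suc)
  have "(card (?V (n1 + n2 - 1)))\<^sup>2 = q ^ (2 * (n1 + n2 - 1))"
    using card_unipotent_kernel[OF assms(1), of "n1 + n2 - 1"] assms(4)
    by (simp add: mult.commute flip: power_mult)
  also have "\<dots> \<le> q ^ m" using assms(4) q_ge_2 by (intro power_increasing) auto
  finally show "(card (?V (n1 + n2 - 1)))\<^sup>2 \<le> CARD('b)" by (simp add: card_extension)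
  show "x * y \<in> ?V (n1 + n2 - 1)" if "x \<in> ?V n1" "y \<in> ?V n2" for x y
    using unipotent_kernel_mult[of x i y j] that by (simp add: ij)
qed (rule frobenius_unipotent_kernel)

section \<open>Extensions of degree at least the product of the dimensions\<close>

lemma primitive_element_exists:
  "\<exists>\<theta> :: 'b. \<theta> \<noteq> 0 \<and> (\<forall>x. x \<noteq> 0 \<longrightarrow> (\<exists>i. x = \<theta> ^ i))"
proof -
  have "\<exists>a\<in>carrier (mult_of (class_ring :: 'b ring)).
      carrier (mult_of class_ring) = {a [^]\<^bsub>class_ring\<^esub> i | i :: nat. i \<in> UNIV}"
    by (rule field.finite_field_mult_group_has_gen[OF class_field]) simp
  then obtain \<theta> :: 'b where \<theta>: "\<theta> \<noteq> 0" "UNIV - {0} = {\<theta> ^ i | i :: nat. i \<in> UNIV}"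
    by (auto simp: class_ring_simps)
  have "\<exists>i. x = \<theta> ^ i" if "x \<noteq> 0" for x
  proof -
    have "x \<in> UNIV - {0}" using that by simp
    then show ?thesis unfolding \<theta>(2) by simp
  qed
  with \<theta>(1) show ?thesis by (intro exI[of _ \<theta>] conjI) simp_all
qed

text \<open>A relation of degree $d < m$ would make the span of $1, \dots, \theta^{d-1}$ stable under
  multiplication by $\theta$. It would then contain all powers of $\theta$, that is all of $K$,
  which has more than $q^d$ elements.\<close>
lemma independent_powers_of_primitive_element:
  assumes \<theta>: "\<theta> \<noteq> 0" "\<And>x :: 'b. x \<noteq> 0 \<Longrightarrow> \<exists>i. x = \<theta> ^ i"
  shows "independent_family m (\<lambda>i. \<theta> ^ i)"
  unfolding independent_family_def
proof (intro allI impI, rule ccontr)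
  fix c i assume sum0: "(\<Sum>i<m. \<iota> (c i) * \<theta> ^ i) = 0" and i: "i < m" "c i \<noteq> 0"
  define d where "d = Max {i. i < m \<and> c i \<noteq> 0}"
  have fin: "finite {i. i < m \<and> c i \<noteq> 0}" by simp
  have d: "d < m" "c d \<noteq> 0"
    using Max_in[OF fin] i unfolding d_def by blast+
  have "c k = 0" if "d < k" "k < m" for k
    using Max_ge[OF fin, of k] that unfolding d_def by fastforce
  then have "(\<Sum>i<m. \<iota> (c i) * \<theta> ^ i) = (\<Sum>i<Suc d. \<iota> (c i) * \<theta> ^ i)"
    using d(1) by (intro sum.mono_neutral_right) auto
  with sum0 have "\<iota> (c d) * \<theta> ^ d = - (\<Sum>i<d. \<iota> (c i) * \<theta> ^ i)"
    by (simp add: eq_neg_iff_add_eq_0 add.commute)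
  moreover have "\<theta> ^ d = \<iota> (- inverse (c d)) * z" if "\<iota> (c d) * \<theta> ^ d = - z" for z
    using that d(2) by (simp add: hom_distribs field_simps)
  ultimately have \<theta>d: "\<theta> ^ d = \<iota> (- inverse (c d)) * (\<Sum>i<d. \<iota> (c i) * \<theta> ^ i)" by blast
  let ?S = "family_span d (\<lambda>i. \<theta> ^ i)"
  note sub = subspace_family_span[of d "\<lambda>i. \<theta> ^ i"]
  have pow_in: "\<theta> ^ i \<in> ?S" if "i < d" for i
  proof -
    have "(\<Sum>j<d. \<iota> (if j = i then 1 else 0) * \<theta> ^ j) = (\<Sum>j<d. if j = i then \<theta> ^ j else 0)"
      by (intro sum.cong) auto
    also have "\<dots> = \<theta> ^ i" using that by simp
    finally show ?thesis
      unfolding family_span_def by (intro range_eqI[of _ _ "\<lambda>j. if j = i then 1 else 0"]) (rule sym)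
  qed
  have top: "\<theta> ^ d \<in> ?S"
    unfolding \<theta>d by (rule K.subspace_scale[OF sub]) (simp add: family_span_def)
  have shift: "\<theta> * x \<in> ?S" if x: "x \<in> ?S" for x
  proof -
    obtain b where "x = (\<Sum>i<d. \<iota> (b i) * \<theta> ^ i)" using x unfolding family_span_def by blast
    then have "\<theta> * x = (\<Sum>i<d. \<iota> (b i) * \<theta> ^ Suc i)"
      by (simp add: sum_distrib_left algebra_simps)
    also have "\<dots> \<in> ?S"
    proof (intro K.subspace_sum[OF sub] K.subspace_scale[OF sub])
      fix i assume "i \<in> {..<d}"
      then show "\<theta> ^ Suc i \<in> ?S" using pow_in[of "Suc i"] top by (cases "Suc i = d") auto
    qed
    finally show ?thesis .
  qed
  have "d \<noteq> 0"
  proof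
    assume "d = 0"
    then show False using sum0 \<theta>d by simp
  qed
  then have "1 \<in> ?S" using pow_in[of 0] by simp
  then have "\<theta> ^ i \<in> ?S" for i
    by (induction i) (simp_all add: shift)
  then have "x \<in> ?S" for x using \<theta>(2) K.subspace_0[OF sub] by (cases "x = 0") auto
  then have "CARD('b) \<le> card ?S" by (intro card_mono) auto
  also have "\<dots> \<le> q ^ d" by (rule card_family_span_le)
  also have "\<dots> < q ^ m" using d(1) q_ge_2 by simp
  finally show False by (simp add: card_extension)
qed

text \<open>The products $\theta^{i + n_1 j}$ of the two spanning families are distinct powers below $\theta^m$.
  So an equation between products means equality of the coefficient matrices $a_i b'_j = a'_i b_j$, and
  a nonzero $b'_j$ makes $a$ a multiple of $a'$.\<close>
lemma ratio_disjoint_dims_product: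
  assumes "n1 * n2 \<le> m" "n1 \<ge> 1" "n2 \<ge> 1"
  shows "ratio_disjoint_dims n1 n2"
proof -
  obtain \<theta> :: 'b where "\<theta> \<noteq> 0" "\<And>x. x \<noteq> 0 \<Longrightarrow> \<exists>i. x = \<theta> ^ i"
    using primitive_element_exists by blast
  then have ind_m: "independent_family m (\<lambda>i. \<theta> ^ i)" by (rule independent_powers_of_primitive_element)
  have ind: "c i j = 0"
    if sum0: "(\<Sum>i<n1. \<Sum>j<n2. \<iota> (c i j) * \<theta> ^ (i + n1 * j)) = 0" and ij: "i < n1" "j < n2" for c i j
  proof -
    \<comment> \<open>Every exponent below \<open>n1 * n2\<close> is \<open>i + n1 * j\<close> for exactly one pair of indices.\<close>
    define c' where "c' = (\<lambda>k. if k < n1 * n2 then c (k mod n1) (k div n1) else 0)"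
    have "(\<Sum>k<m. \<iota> (c' k) * \<theta> ^ k) = (\<Sum>k<n1*n2. \<iota> (c' k) * \<theta> ^ k)"
      using assms(1) by (intro sum.mono_neutral_right) (auto simp: c'_def)
    also have "\<dots> = (\<Sum>(i, j)\<in>{..<n1} \<times> {..<n2}. \<iota> (c i j) * \<theta> ^ (i + n1 * j))"
    proof (rule sum.reindex_bij_witness[of _ "\<lambda>(i, j). i + n1 * j" "\<lambda>k. (k mod n1, k div n1)"])
      fix k assume k: "k \<in> {..<n1 * n2}"
      then show "(k mod n1, k div n1) \<in> {..<n1} \<times> {..<n2}"
        using assms by (auto simp: less_mult_imp_div_less mult.commute)
      show "(case (k mod n1, k div n1) of (i, j) \<Rightarrow> \<iota> (c i j) * \<theta> ^ (i + n1 * j)) = \<iota> (c' k) * \<theta> ^ k"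
        using k by (simp add: c'_def)
    next
      fix p assume "p \<in> {..<n1} \<times> {..<n2}"
      then obtain i j where p: "p = (i, j)" "i < n1" "j < n2" by auto
      have "i + n1 * j < n1 * Suc j" using p by simp
      also have "\<dots> \<le> n1 * n2" using p(3) by (intro mult_le_mono2) simp
      finally show "(case p of (i, j) \<Rightarrow> i + n1 * j) \<in> {..<n1 * n2}" using p by simp
      show "((case p of (i, j) \<Rightarrow> i + n1 * j) mod n1, (case p of (i, j) \<Rightarrow> i + n1 * j) div n1) = p"
        using p by simp
    qed simp
    also have "\<dots> = 0" using sum0 by (simp add: sum.cartesian_product)
    finally have z: "(\<Sum>k<m. \<iota> (c' k) * \<theta> ^ k) = 0" .
    have "i + n1 * j < n1 * Suc j" using ij by simp
    also have "\<dots> \<le> n1 * n2" using ij(2) by (intro mult_le_mono2) simp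
    finally have lt: "i + n1 * j < n1 * n2" .
    then have "c' (i + n1 * j) = 0"
      using ind_m[unfolded independent_family_def, THEN spec[of _ c']] z assms(1) by force
    then show ?thesis using lt ij by (simp add: c'_def)
  qed
  define A where "A = family_span n1 (\<lambda>i. \<theta> ^ i)"
  define B where "B = family_span n2 (\<lambda>j. \<theta> ^ (n1 * j))"
  have "independent_family n1 (\<lambda>i. \<theta> ^ i)"
    unfolding independent_family_def
  proof (intro allI impI)
    fix c i assume c: "(\<Sum>i<n1. \<iota> (c i) * \<theta> ^ i) = 0" "i < n1"
    have "(\<Sum>i<n1. \<Sum>j<n2. \<iota> (if j = 0 then c i else 0) * \<theta> ^ (i + n1 * j)) = (\<Sum>i<n1. \<iota> (c i) * \<theta> ^ i)"
    proof (rule sum.cong)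
      fix i
      have "(\<Sum>j<n2. \<iota> (if j = 0 then c i else 0) * \<theta> ^ (i + n1 * j))
          = (\<Sum>j<n2. if j = 0 then \<iota> (c i) * \<theta> ^ i else 0)"
        by (intro sum.cong) auto
      then show "(\<Sum>j<n2. \<iota> (if j = 0 then c i else 0) * \<theta> ^ (i + n1 * j)) = \<iota> (c i) * \<theta> ^ i"
        using assms(3) by simp
    qed simp
    then show "c i = 0" using ind[of "\<lambda>i j. if j = 0 then c i else 0" i 0] c assms(3) by simp
  qed
  moreover have "independent_family n2 (\<lambda>j. \<theta> ^ (n1 * j))"
    unfolding independent_family_def
  proof (intro allI impI)
    fix c j assume c: "(\<Sum>j<n2. \<iota> (c j) * \<theta> ^ (n1 * j)) = 0" "j < n2"
    have "(\<Sum>i<n1. \<Sum>j<n2. \<iota> (if i = 0 then c j else 0) * \<theta> ^ (i + n1 * j))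
        = (\<Sum>i<n1. if i = 0 then \<Sum>j<n2. \<iota> (c j) * \<theta> ^ (n1 * j) else 0)"
      by (intro sum.cong) auto
    then show "c j = 0" using ind[of "\<lambda>i j. if i = 0 then c j else 0" 0 j] c assms(2) by simp
  qed
  moreover have "ratio_disjoint A B"
    unfolding ratio_disjoint_def
  proof (intro ballI impI)
    fix x x' y y'
    assume "x \<in> A" "x' \<in> A" "y \<in> B" "y' \<in> B" and nz: "x \<noteq> 0" "x' \<noteq> 0" "y \<noteq> 0" "y' \<noteq> 0"
      and eq: "x * y' = x' * y"
    then obtain a a' b b' where ab: "x = (\<Sum>i<n1. \<iota> (a i) * \<theta> ^ i)" "x' = (\<Sum>i<n1. \<iota> (a' i) * \<theta> ^ i)"
      "y = (\<Sum>j<n2. \<iota> (b j) * \<theta> ^ (n1 * j))" "y' = (\<Sum>j<n2. \<iota> (b' j) * \<theta> ^ (n1 * j))"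
      unfolding A_def B_def family_span_def by blast
    have prod: "(\<Sum>i<n1. \<iota> (u i) * \<theta> ^ i) * (\<Sum>j<n2. \<iota> (v j) * \<theta> ^ (n1 * j))
        = (\<Sum>i<n1. \<Sum>j<n2. \<iota> (u i * v j) * \<theta> ^ (i + n1 * j))" for u v
      by (simp add: sum_product hom_mult power_add ac_simps)
    have z: "(\<Sum>i<n1. \<Sum>j<n2. \<iota> (a i * b' j - a' i * b j) * \<theta> ^ (i + n1 * j)) = 0"
      using eq unfolding ab prod by (simp add: hom_minus left_diff_distrib sum_subtractf)
    have coef: "a i * b' j = a' i * b j" if "i < n1" "j < n2" for i j
    proof -
      have "a i * b' j - a' i * b j = 0"
        by (rule ind[of "\<lambda>i j. a i * b' j - a' i * b j", OF z that])
      then show ?thesis by (rule eq_iff_diff_eq_0[THEN iffD2])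
    qed
    have "\<exists>j<n2. b' j \<noteq> 0"
    proof (rule ccontr)
      assume "\<not> (\<exists>j<n2. b' j \<noteq> 0)"
      then show False using nz(4) by (simp add: ab(4))
    qed
    then obtain j where j: "j < n2" "b' j \<noteq> 0" by blast
    have "x = \<iota> (b j / b' j) * x'"
      unfolding ab sum_distrib_left
    proof (rule sum.cong)
      fix i assume "i \<in> {..<n1}"
      then have "a i = b j / b' j * a' i" using coef[of i j] j by (simp add: field_simps)
      then show "\<iota> (a i) * \<theta> ^ i = \<iota> (b j / b' j) * (\<iota> (a' i) * \<theta> ^ i)"
        by (simp only: hom_mult mult.assoc)
    qed simp
    then show "x / x' \<in> range \<iota>" using nz(2) by simp
  qed
  ultimately show ?thesis
    unfolding ratio_disjoint_dims_def A_def B_def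
    by (intro exI[of _ "family_span n1 (\<lambda>i. \<theta> ^ i)"] exI[of _ "family_span n2 (\<lambda>j. \<theta> ^ (n1 * j))"])
       (simp add: card_family_span subspace_family_span)
qed

section \<open>Scattered subspaces\<close>

text \<open>The condition on \<open>B\<close> is that of a scattered subspace: two vectors of \<open>B\<close> on a common line over the
  intermediate field are already parallel over $F$.\<close>

lemma ratio_disjoint_intermediate_field_iff:
  "ratio_disjoint (intermediate_field t) B \<longleftrightarrow>
     (\<forall>y\<in>B. \<forall>y'\<in>B. y \<noteq> 0 \<longrightarrow> y' \<noteq> 0 \<longrightarrow> y / y' \<in> intermediate_field t \<longrightarrow> y / y' \<in> range \<iota>)"
proof
  assume L: "ratio_disjoint (intermediate_field t) B"
  show "\<forall>y\<in>B. \<forall>y'\<in>B. y \<noteq> 0 \<longrightarrow> y' \<noteq> 0 \<longrightarrow> y / y' \<in> intermediate_field t \<longrightarrow> y / y' \<in> range \<iota>"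
  proof (intro ballI impI)
    fix y y' assume "y \<in> B" "y' \<in> B" "y \<noteq> 0" "y' \<noteq> 0" "y / y' \<in> intermediate_field t"
    then show "y / y' \<in> range \<iota>"
      using L[unfolded ratio_disjoint_def, rule_format, of "y / y'" 1 y y']
        base_in_intermediate_field[of 1 t] by simp
  qed
next
  assume R: "\<forall>y\<in>B. \<forall>y'\<in>B. y \<noteq> 0 \<longrightarrow> y' \<noteq> 0 \<longrightarrow> y / y' \<in> intermediate_field t \<longrightarrow> y / y' \<in> range \<iota>"
  show "ratio_disjoint (intermediate_field t) B"
    unfolding ratio_disjoint_def
  proof (intro ballI impI)
    fix x x' y y'
    assume xy: "x \<in> intermediate_field t" "x' \<in> intermediate_field t" "y \<in> B" "y' \<in> B"
      "x \<noteq> 0" "x' \<noteq> 0" "y \<noteq> 0" "y' \<noteq> 0" "x * y' = x' * y"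
    then have "x / x' = y / y'" by (simp add: field_simps)
    with xy show "x / x' \<in> range \<iota>" using R intermediate_field_divide by metis
  qed
qed

text \<open>Any \<open>w\<close> outside $B + L \cdot B$ may be added. If $y/y' = l$ with $l \in L$, $y = u + cw$ and $y' = u' + c'w$, then
  $(c - lc')w = lu' - u$. A nonzero $\nu = c - lc'$ would place \<open>w\<close> in $B + L \cdot B$: directly if
  $c' = 0$, and otherwise after substituting $l = (c - \nu)/c'$, which collects all multiples outside $F$
  in front of a single vector of $B$. So $c = lc'$, and $l \in F$ unless $c = c' = 0$. The set
  $B + L \cdot B$ has fewer than $q^{2k+t}$ elements since $(0, l, 0)$ gives the same element for all $l$.\<close>
lemma scattered_subspace_extend:
  assumes B: "K.subspace B" "card B = q ^ k" "ratio_disjoint (intermediate_field t) B"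
    and t: "t > 0" "2 * k + t \<le> m"
  shows "\<exists>B'. K.subspace B' \<and> card B' = q ^ Suc k \<and> ratio_disjoint (intermediate_field t) B'"
proof -
  let ?L = "intermediate_field t"
  let ?f = "\<lambda>(u, l, u'). u + l * u' :: 'b"
  note L = subspace_intermediate_field[of t]
  have "(0, 0, 0) \<in> B \<times> ?L \<times> B" "(0, 1, 0) \<in> B \<times> ?L \<times> B"
    using K.subspace_0[OF B(1)] K.subspace_0[OF L] base_in_intermediate_field[of 1 t] by simp_all
  moreover have "?f (0, 0, 0) = ?f (0, 1, 0)" by simp
  ultimately have "\<not> inj_on ?f (B \<times> ?L \<times> B)"
    unfolding inj_on_def by (metis (no_types, lifting) prod.inject zero_neq_one)
  then have "card (?f ` (B \<times> ?L \<times> B)) < card (B \<times> ?L \<times> B)"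
    using card_image_le[of "B \<times> ?L \<times> B" ?f] eq_card_imp_inj_on[of "B \<times> ?L \<times> B" ?f] by force
  also have "\<dots> \<le> q ^ k * (q ^ t * q ^ k)"
    using B(2) card_intermediate_field_le[OF t(1)] by (simp add: card_cartesian_product)
  also have "\<dots> \<le> q ^ m"
    unfolding power_add[symmetric] using t(2) q_ge_2 by (intro power_increasing) auto
  finally have "?f ` (B \<times> ?L \<times> B) \<noteq> UNIV" using card_extension by auto
  then obtain w where "w \<notin> ?f ` (B \<times> ?L \<times> B)" by blast
  then have w: "w \<noteq> u + l * u'" if "u \<in> B" "l \<in> ?L" "u' \<in> B" for u l u'
    using that by force
  define h where "h = (\<lambda>(u, c). u + \<iota> c * w)"
  define B' where "B' = h ` (B \<times> UNIV)"
  have B'I: "u + \<iota> c * w \<in> B'" if "u \<in> B" for u c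
    unfolding B'_def h_def using that by (intro image_eqI[of _ _ "(u, c)"]) auto
  have sub: "K.subspace B'"
  proof (rule K.subspaceI)
    show "0 \<in> B'" using B'I[OF K.subspace_0[OF B(1)], of 0] by simp
  next
    fix x y assume "x \<in> B'" "y \<in> B'"
    then obtain u c v d where "u \<in> B" "v \<in> B" "x = u + \<iota> c * w" "y = v + \<iota> d * w"
      unfolding B'_def h_def by auto
    then show "x + y \<in> B'"
      using B'I[OF K.subspace_add[OF B(1)], of u v "c + d"] by (simp add: hom_add algebra_simps)
  next
    fix a x assume "x \<in> B'"
    then obtain u c where "u \<in> B" "x = u + \<iota> c * w" unfolding B'_def h_def by auto
    then show "\<iota> a * x \<in> B'"
      using B'I[OF K.subspace_scale[OF B(1)], of u a "a * c"] by (simp add: hom_mult algebra_simps)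
  qed
  have inj: "inj_on h (B \<times> UNIV)"
  proof (rule inj_onI, clarsimp simp: h_def)
    fix u c v d assume uv: "u \<in> B" "v \<in> B" and eq: "u + \<iota> c * w = v + \<iota> d * w"
    have "c = d"
    proof (rule ccontr)
      assume "c \<noteq> d"
      with eq have "w = 0 + \<iota> (inverse (c - d)) * (v - u)"
        by (simp add: hom_distribs field_simps)
      then show False
        using w[of 0 "\<iota> (inverse (c - d))" "v - u"] uv base_in_intermediate_field
          K.subspace_0[OF B(1)] K.subspace_diff[OF B(1)] by blast
    qed
    with eq show "u = v \<and> c = d" by simp
  qed
  have card: "card B' = q ^ Suc k"
    unfolding B'_def card_image[OF inj] by (simp add: card_cartesian_product B(2) card_base)
  have "y / y' \<in> range \<iota>"
    if "y \<in> B'" "y' \<in> B'" "y \<noteq> 0" "y' \<noteq> 0" "y / y' \<in> ?L" for y y'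
  proof -
    obtain u c u' c' where u: "u \<in> B" "u' \<in> B" "y = u + \<iota> c * w" "y' = u' + \<iota> c' * w"
      using \<open>y \<in> B'\<close> \<open>y' \<in> B'\<close> unfolding B'_def h_def by auto
    define l where "l = y / y'"
    define \<nu> where "\<nu> = \<iota> c - l * \<iota> c'"
    have l: "l \<in> ?L" using that by (simp add: l_def)
    have \<nu>L: "\<nu> \<in> ?L"
      unfolding \<nu>_def by (intro K.subspace_diff[OF L] intermediate_field_mult base_in_intermediate_field l)
    have "y = l * y'" using that(4) by (simp add: l_def)
    then have eq: "\<nu> * w = l * u' - u" unfolding u(3,4) \<nu>_def by (simp add: algebra_simps)
    have "\<nu> = 0"
    proof (rule ccontr)
      assume \<nu>: "\<nu> \<noteq> 0"
      show False
      proof (cases "c' = 0")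
        case True
        then have "w = \<iota> (- inverse c) * u + (l / \<nu>) * u'"
          using eq \<nu> by (simp add: \<nu>_def hom_distribs field_simps)
        then show False
          using w[of "\<iota> (- inverse c) * u" "l / \<nu>" u'] u(1,2) K.subspace_scale[OF B(1)]
            intermediate_field_divide[OF l \<nu>L] by blast
      next
        case False
        have "l = (\<iota> c - \<nu>) / \<iota> c'" using False by (simp add: \<nu>_def)
        with eq have "w = ((\<iota> c - \<nu>) / \<iota> c' * u' - u) / \<nu>"
          using \<nu> by (simp add: nonzero_eq_divide_eq mult.commute)
        also have "\<dots> = \<iota> (- inverse c') * u' + (1 / \<nu>) * (\<iota> (c / c') * u' - u)"
          using False \<nu> by (simp add: hom_distribs field_simps)
        finally have "w = \<iota> (- inverse c') * u' + (1 / \<nu>) * (\<iota> (c / c') * u' - u)" .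
        moreover have "1 / \<nu> \<in> ?L"
          using intermediate_field_divide[OF base_in_intermediate_field[of 1 t] \<nu>L] by simp
        ultimately show False
          using w[of "\<iota> (- inverse c') * u'" "1 / \<nu>" "\<iota> (c / c') * u' - u"] u(1,2)
            K.subspace_scale[OF B(1)] K.subspace_diff[OF B(1)] by blast
      qed
    qed
    show ?thesis
    proof (cases "c' = 0")
      case True
      with \<open>\<nu> = 0\<close> have "c = 0" by (simp add: \<nu>_def)
      with True u have "y \<in> B" "y' \<in> B" by simp_all
      with B(3) that show ?thesis unfolding ratio_disjoint_intermediate_field_iff by blast
    next
      case False
      with \<open>\<nu> = 0\<close> have "l = \<iota> (c / c')" by (simp add: \<nu>_def hom_distribs field_simps)
      then show ?thesis unfolding l_def by (metis rangeI)
    qed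
  qed
  then have "ratio_disjoint ?L B'" unfolding ratio_disjoint_intermediate_field_iff by blast
  with sub card show ?thesis by blast
qed

text \<open>The last vector is added to a space of dimension $k - 1$, which accounts for the summand 2.\<close>
lemma scattered_subspace_exists:
  assumes "t > 0" "2 * k + t \<le> m + 2"
  shows "\<exists>B. K.subspace B \<and> card B = q ^ k \<and> ratio_disjoint (intermediate_field t) B"
  using assms(2)
proof (induction k)
  case 0
  show ?case
    by (intro exI[of _ "{0}"]) (simp add: ratio_disjoint_def K.subspace_def)
next
  case (Suc k)
  then obtain B where "K.subspace B" "card B = q ^ k" "ratio_disjoint (intermediate_field t) B"
    by auto
  then show ?case using scattered_subspace_extend[of B k t] Suc.prems assms(1) by simp
qed

lemma ratio_disjoint_dims_scattered:
  assumes "m = t * s" "t > 0" "s > 0" "n1 \<le> t" "2 * n2 + t \<le> m + 2"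
  shows "ratio_disjoint_dims n1 n2"
proof -
  obtain B where B: "K.subspace B" "card B = q ^ n2" "ratio_disjoint (intermediate_field t) B"
    using scattered_subspace_exists[OF assms(2,5)] by blast
  have "q ^ n1 \<le> q ^ t" using assms(4) q_ge_2 by (intro power_increasing) auto
  also have "\<dots> \<le> card (intermediate_field t)" by (rule card_intermediate_field_ge[OF assms(1-3)])
  finally show ?thesis
    unfolding ratio_disjoint_dims_def using B subspace_intermediate_field by (metis order_refl)
qed

section \<open>Existence under the arithmetic conditions\<close>

lemma ratio_disjoint_dims_exist:
  assumes "n1 \<ge> 2" "n2 \<ge> 2"
    and "(even m \<and> m \<ge> 2 * max n1 n2)
       \<or> m \<ge> n1 * n2
       \<or> (\<exists>t1 t2 :: nat. t1 > 0 \<and> t2 > 0 \<and> m = t1 * t2 \<and> t1 \<ge> n1 \<and>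
            real n2 \<le> real t1 * (real t2 - 1) / 2 + 1)
       \<or> (\<exists>t1 t2 :: nat. t1 > 0 \<and> t2 > 0 \<and> m = t1 * t2 \<and> t1 \<ge> n1 \<and> t1 \<ge> n2 \<and> t2 \<ge> 2)
       \<or> (\<exists>p h r :: nat. prime p \<and> h > 0 \<and> r > 0 \<and> q = p ^ h \<and> m = p ^ r \<and>
            real n1 + real n2 - 1 \<le> real m / 2)"
  shows "ratio_disjoint_dims n1 n2"
  using assms(3)
proof (elim disjE exE conjE)
  assume "even m" "m \<ge> 2 * max n1 n2"
  then obtain t where "m = t * 2" "n1 \<le> t" "n2 \<le> t" by (auto elim: evenE)
  then show ?thesis using ratio_disjoint_dims_intermediate[of t 2] assms(1) by simp
next
  assume "m \<ge> n1 * n2"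
  then show ?thesis using ratio_disjoint_dims_product assms by simp
next
  fix t1 t2 assume t: "t1 > 0" "t2 > 0" "m = t1 * t2" "t1 \<ge> n1" "real n2 \<le> real t1 * (real t2 - 1) / 2 + 1"
  have "real (2 * n2 + t1) \<le> real (m + 2)" using t(3,5) by (simp add: field_simps)
  then have "2 * n2 + t1 \<le> m + 2" by (simp only: of_nat_le_iff)
  then show ?thesis using ratio_disjoint_dims_scattered t by blast
next
  fix t1 t2 assume "t1 > 0" "m = t1 * t2" "t1 \<ge> n1" "t1 \<ge> n2" "t2 \<ge> 2"
  then show ?thesis using ratio_disjoint_dims_intermediate by blast
next
  fix p h r assume p: "prime p" "h > 0" "q = p ^ h" "m = p ^ r" "real n1 + real n2 - 1 \<le> real m / 2"
  obtain h' where h': "q = CHAR('b) ^ h'" using card_eq_CHAR_power by blast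
  have "p dvd CHAR('b) ^ h'" using p h' by (metis dvd_power)
  then have "p = CHAR('b)"
    using p(1) prime_CHAR prime_dvd_power primes_dvd_imp_eq by blast
  moreover have "real (2 * (n1 + n2 - 1)) \<le> real m" using p(5) assms(1) by (simp add: of_nat_diff)
  then have "2 * (n1 + n2 - 1) \<le> m" by (simp only: of_nat_le_iff)
  ultimately show ?thesis using ratio_disjoint_dims_unipotent[of r] p(4) assms by simp
qed

end

section \<open>Subspaces of coordinate space and their dimension\<close>

lemma vsubspaceI:
  fixes W :: "'a::field vec set"
  assumes "W \<subseteq> carrier_vec n" "0\<^sub>v n \<in> W"
    and "\<And>u v. u \<in> W \<Longrightarrow> v \<in> W \<Longrightarrow> u + v \<in> W" "\<And>c v. v \<in> W \<Longrightarrow> c \<cdot>\<^sub>v v \<in> W"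
  shows "vsubspace n W"
  unfolding VectorSpace.subspace_def submodule_def
  using assms vec_vs vec_module by (auto simp: module_vec_simps)

lemma
  fixes W :: "'a::field vec set"
  assumes "vsubspace n W"
  shows vsubspace_carrier: "W \<subseteq> carrier_vec n"
    and vsubspace_zero: "0\<^sub>v n \<in> W"
    and vsubspace_add: "\<And>u v. u \<in> W \<Longrightarrow> v \<in> W \<Longrightarrow> u + v \<in> W"
    and vsubspace_smult: "\<And>c v. v \<in> W \<Longrightarrow> c \<cdot>\<^sub>v v \<in> W"
  using assms[unfolded VectorSpace.subspace_def submodule_def]
  by (auto simp: module_vec_simps)

lemma vsubspace_trivial: "vsubspace n {0\<^sub>v n :: 'a::field vec}"
  by (rule vsubspaceI) auto

lemma vsubspace_full: "vsubspace n (carrier_vec n :: 'a::field vec set)"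
  by (rule vsubspaceI) auto

lemma vsubspace_Int: "vsubspace n U \<Longrightarrow> vsubspace n W \<Longrightarrow> vsubspace n (U \<inter> W)"
  by (rule vsubspaceI)
    (auto intro: vsubspace_zero vsubspace_add vsubspace_smult dest: vsubspace_carrier)

lemma vsubspace_span:
  fixes S :: "'a::field vec set"
  assumes "S \<subseteq> carrier_vec n"
  shows "vsubspace n (LinearCombinations.module.span class_ring (module_vec TYPE('a) n) S)"
proof -
  interpret V: vec_space "TYPE('a)" n .
  show ?thesis using V.span_is_subspace assms by simp
qed

text \<open>Independence and spanning are transferred from the subspace to the ambient space, where the columns
  of different basis matrices can be compared.\<close>
lemma basis_matrixD:
  fixes U :: "'a::{field,finite} vec set"
  assumes U: "vsubspace n U" and A: "is_basis_matrix n U A"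
  shows "A \<in> carrier_mat n (vsdim n U)"
    and "set (cols A) \<subseteq> U"
    and "module.span class_ring (module_vec TYPE('a) n) (set (cols A)) = U"
    and "\<not> module.lin_dep class_ring (module_vec TYPE('a) n) (set (cols A))"
    and "card (set (cols A)) = vsdim n U"
proof -
  interpret V: vec_space "TYPE('a)" n .
  interpret W: vectorspace class_ring "as_space n U" using V.subspace_is_vs[OF U] .
  have B: "W.basis (set (cols A))" and dist: "distinct (cols A)" and row: "dim_row A = n"
    using A unfolding is_basis_matrix_def by auto
  have sub: "submodule class_ring U V.V" using subspace.submod[OF U] .
  show le: "set (cols A) \<subseteq> U" using B unfolding W.basis_def by simp
  show "V.span (set (cols A)) = U" "\<not> V.lin_dep (set (cols A))"
    using B V.span_li_not_depend[OF le sub] unfolding W.basis_def by simp_all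
  show card: "card (set (cols A)) = vsdim n U"
    unfolding vsdim_def by (rule W.dim_basis[symmetric]) (use B in simp_all)
  show "A \<in> carrier_mat n (vsdim n U)"
    using card dist row by (auto simp: distinct_card cols_length)
qed

lemma vsdim_le_card:
  fixes U :: "'a::{field,finite} vec set"
  assumes U: "vsubspace n U" and S: "finite S" "S \<subseteq> U"
    and "U \<subseteq> module.span class_ring (module_vec TYPE('a) n) S"
  shows "vsdim n U \<le> card S"
proof -
  interpret V: vec_space "TYPE('a)" n .
  interpret W: vectorspace class_ring "as_space n U" using V.subspace_is_vs[OF U] .
  have sub: "submodule class_ring U V.V" using subspace.submod[OF U] .
  have "W.span S = U"
    using V.span_li_not_depend(1)[OF S(2) sub] V.span_is_subset[OF S(2) sub] assms(4) by auto
  then show ?thesis unfolding vsdim_def using S by (intro W.gen_ge_dim) auto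
qed

text \<open>A basis of \<open>U\<close> stays independent when a vector of \<open>W\<close> outside \<open>U\<close> is added. Nearly all statements on
  dimension below are consequences of this one.\<close>
lemma vsdim_strict_mono:
  fixes U W :: "'a::{field,finite} vec set"
  assumes U: "vsubspace n U" and W: "vsubspace n W" and "U \<subset> W"
  shows "vsdim n U < vsdim n W"
proof -
  interpret V: vec_space "TYPE('a)" n .
  interpret W: vectorspace class_ring "as_space n W" using V.subspace_is_vs[OF W] .
  obtain A where A: "is_basis_matrix n U A" using basis_matrix_exists[OF U] by blast
  obtain C where C: "is_basis_matrix n W C" using basis_matrix_exists[OF W] by blast
  note A = basis_matrixD[OF U A] and C = C basis_matrixD[OF W C]
  obtain w where w: "w \<in> W" "w \<notin> U" using \<open>U \<subset> W\<close> by blast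
  let ?B = "set (cols A)"
  have BV: "?B \<subseteq> carrier_vec n" using A(2) vsubspace_carrier[OF U] by blast
  have wV: "w \<in> carrier_vec n" using w(1) vsubspace_carrier[OF W] by blast
  have wB: "w \<notin> ?B" using A(2) w(2) by blast
  have "\<not> V.lin_dep (?B \<union> {w})"
    using V.lin_dep_iff_in_span[of ?B w] A(3,4) BV wV wB w(2) by simp
  moreover have BW: "?B \<union> {w} \<subseteq> W" using A(2) w(1) \<open>U \<subset> W\<close> by blast
  ultimately have li: "W.lin_indpt (?B \<union> {w})"
    using V.span_li_not_depend(2)[OF BW subspace.submod[OF W]] by simp
  have "W.basis (set (cols C))" using C(1) unfolding is_basis_matrix_def by simp
  then have fd: "W.fin_dim" unfolding W.fin_dim_def W.basis_def by blast
  have "card (?B \<union> {w}) \<le> W.dim" by (rule W.li_le_dim(2)[OF fd _ li]) (use BW in simp)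
  then show ?thesis using A(5) wB unfolding vsdim_def by simp
qed

lemma vsdim_mono:
  fixes U W :: "'a::{field,finite} vec set"
  assumes "vsubspace n U" "vsubspace n W" "U \<subseteq> W"
  shows "vsdim n U \<le> vsdim n W"
  using vsdim_strict_mono[OF assms(1,2)] assms(3) by (metis less_imp_le order_refl psubsetI)

lemma vsdim_trivial: "vsdim n {0\<^sub>v n :: 'a::{field,finite} vec} = 0"
proof -
  interpret V: vec_space "TYPE('a)" n .
  have "vsdim n {0\<^sub>v n :: 'a vec} \<le> card ({} :: 'a vec set)"
    by (rule vsdim_le_card) (simp_all add: vsubspace_trivial V.span_empty)
  then show ?thesis by simp
qed

lemma vsdim_eq_0_iff:
  fixes U :: "'a::{field,finite} vec set"
  assumes "vsubspace n U"
  shows "vsdim n U = 0 \<longleftrightarrow> U = {0\<^sub>v n}"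
proof (cases "U = {0\<^sub>v n}")
  case False
  then have "{0\<^sub>v n} \<subset> U" using vsubspace_zero[OF assms] by blast
  then show ?thesis using vsdim_strict_mono[OF vsubspace_trivial assms] False by simp
qed (simp add: vsdim_trivial)

lemma vsdim_full: "vsdim n (carrier_vec n :: 'a::{field,finite} vec set) = n"
proof -
  interpret V: vec_space "TYPE('a)" n .
  have "as_space n (carrier_vec n :: 'a vec set) = V.V" by (simp add: module_vec_def)
  then show ?thesis by (simp only: vsdim_def V.dim_is_n)
qed

section \<open>The direct sum of two uniform q-matroids of rank one\<close>

definition left_summand :: "nat \<Rightarrow> nat \<Rightarrow> 'a::field vec set" where
  "left_summand n1 n2 = {v \<in> carrier_vec (n1 + n2). vec_last v n2 = 0\<^sub>v n2}"

definition right_summand :: "nat \<Rightarrow> nat \<Rightarrow> 'a::field vec set" where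
  "right_summand n1 n2 = {v \<in> carrier_vec (n1 + n2). vec_first v n1 = 0\<^sub>v n1}"

lemma vec_first_zero: "vec_first (0\<^sub>v (n1 + n2)) n1 = 0\<^sub>v n1"
  and vec_last_zero: "vec_last (0\<^sub>v (n1 + n2)) n2 = 0\<^sub>v n2"
  by (auto simp: vec_first_def vec_last_def)

lemma vec_first_add: "u \<in> carrier_vec (n1 + n2) \<Longrightarrow> v \<in> carrier_vec (n1 + n2) \<Longrightarrow>
    vec_first (u + v) n1 = vec_first u n1 + vec_first v n1"
  and vec_last_add: "u \<in> carrier_vec (n1 + n2) \<Longrightarrow> v \<in> carrier_vec (n1 + n2) \<Longrightarrow>
    vec_last (u + v) n2 = vec_last u n2 + vec_last v n2"
  by (auto simp: vec_first_def vec_last_def)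

lemma vec_first_smult: "v \<in> carrier_vec (n1 + n2) \<Longrightarrow> vec_first (c \<cdot>\<^sub>v v) n1 = c \<cdot>\<^sub>v vec_first v n1"
  and vec_last_smult: "v \<in> carrier_vec (n1 + n2) \<Longrightarrow> vec_last (c \<cdot>\<^sub>v v) n2 = c \<cdot>\<^sub>v vec_last v n2"
  by (auto simp: vec_first_def vec_last_def)

lemma vsubspace_left_summand: "vsubspace (n1 + n2) (left_summand n1 n2)"
  by (rule vsubspaceI) (auto simp: left_summand_def vec_last_zero vec_last_add vec_last_smult)

lemma vsubspace_right_summand: "vsubspace (n1 + n2) (right_summand n1 n2)"
  by (rule vsubspaceI) (auto simp: right_summand_def vec_first_zero vec_first_add vec_first_smult)

lemma left_Int_right_summand:
  "left_summand n1 n2 \<inter> right_summand n1 n2 = {0\<^sub>v (n1 + n2) :: 'a::field vec}"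
proof
  show "left_summand n1 n2 \<inter> right_summand n1 n2 \<subseteq> {0\<^sub>v (n1 + n2) :: 'a vec}"
  proof
    fix v :: "'a vec" assume v: "v \<in> left_summand n1 n2 \<inter> right_summand n1 n2"
    then have c: "v \<in> carrier_vec (n1 + n2)" by (simp add: left_summand_def)
    have "v = vec_first v n1 @\<^sub>v vec_last v n2" using c by simp
    also have "\<dots> = 0\<^sub>v (n1 + n2)" using v by (auto simp: left_summand_def right_summand_def)
    finally show "v \<in> {0\<^sub>v (n1 + n2)}" by simp
  qed
qed (simp add: vsubspace_zero[OF vsubspace_left_summand] vsubspace_zero[OF vsubspace_right_summand])

lemma vsubspace_vec_first:
  assumes "vsubspace (n1 + n2) X"
  shows "vsubspace n1 ((\<lambda>v. vec_first v n1) ` X)"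
proof (rule vsubspaceI)
  note X = vsubspace_carrier[OF assms]
  show "0\<^sub>v n1 \<in> (\<lambda>v. vec_first v n1) ` X"
    using vsubspace_zero[OF assms] vec_first_zero by (metis imageI)
  show "u + v \<in> (\<lambda>v. vec_first v n1) ` X"
    if "u \<in> (\<lambda>v. vec_first v n1) ` X" "v \<in> (\<lambda>v. vec_first v n1) ` X" for u v
  proof -
    from that obtain u' v' where uv: "u' \<in> X" "v' \<in> X" "u = vec_first u' n1" "v = vec_first v' n1" by blast
    then have "u + v = vec_first (u' + v') n1" 
      using vec_first_add[OF subsetD[OF X uv(1)] subsetD[OF X uv(2)]] by simp
    with vsubspace_add[OF assms uv(1,2)] show ?thesis by blast
  qed
  show "c \<cdot>\<^sub>v v \<in> (\<lambda>v. vec_first v n1) ` X" if "v \<in> (\<lambda>v. vec_first v n1) ` X" for c v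
  proof -
    from that obtain v' where v: "v' \<in> X" "v = vec_first v' n1" by blast
    then have "c \<cdot>\<^sub>v v = vec_first (c \<cdot>\<^sub>v v') n1" 
      using vec_first_smult[OF subsetD[OF X v(1)]] by simp
    with vsubspace_smult[OF assms v(1)] show ?thesis by blast
  qed
qed auto

lemma vsubspace_vec_last:
  assumes "vsubspace (n1 + n2) X"
  shows "vsubspace n2 ((\<lambda>v. vec_last v n2) ` X)"
proof (rule vsubspaceI)
  note X = vsubspace_carrier[OF assms]
  show "0\<^sub>v n2 \<in> (\<lambda>v. vec_last v n2) ` X"
    using vsubspace_zero[OF assms] vec_last_zero by (metis imageI)
  show "u + v \<in> (\<lambda>v. vec_last v n2) ` X"
    if "u \<in> (\<lambda>v. vec_last v n2) ` X" "v \<in> (\<lambda>v. vec_last v n2) ` X" for u v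
  proof -
    from that obtain u' v' where uv: "u' \<in> X" "v' \<in> X" "u = vec_last u' n2" "v = vec_last v' n2" by blast
    then have "u + v = vec_last (u' + v') n2" 
      using vec_last_add[OF subsetD[OF X uv(1)] subsetD[OF X uv(2)]] by simp
    with vsubspace_add[OF assms uv(1,2)] show ?thesis by blast
  qed
  show "c \<cdot>\<^sub>v v \<in> (\<lambda>v. vec_last v n2) ` X" if "v \<in> (\<lambda>v. vec_last v n2) ` X" for c v
  proof -
    from that obtain v' where v: "v' \<in> X" "v = vec_last v' n2" by blast
    then have "c \<cdot>\<^sub>v v = vec_last (c \<cdot>\<^sub>v v') n2" 
      using vec_last_smult[OF subsetD[OF X v(1)]] by simp
    with vsubspace_smult[OF assms v(1)] show ?thesis by blast
  qed
qed auto

lemma rank_one_rank_of_first_projection: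
  fixes X :: "'a::{field,finite} vec set"
  assumes "vsubspace (n1 + n2) X"
  shows "min 1 (vsdim n1 ((\<lambda>v. vec_first v n1) ` X)) = (if X \<subseteq> right_summand n1 n2 then 0 else 1)"
proof -
  have "(\<lambda>v. vec_first v n1) ` X = {0\<^sub>v n1} \<longleftrightarrow> X \<subseteq> right_summand n1 n2"
    using vsubspace_carrier[OF assms] vsubspace_zero[OF vsubspace_vec_first[OF assms]]
    by (auto simp: right_summand_def)
  then show ?thesis using vsdim_eq_0_iff[OF vsubspace_vec_first[OF assms]] by auto
qed

lemma rank_one_rank_of_last_projection:
  fixes X :: "'a::{field,finite} vec set"
  assumes "vsubspace (n1 + n2) X"
  shows "min 1 (vsdim n2 ((\<lambda>v. vec_last v n2) ` X)) = (if X \<subseteq> left_summand n1 n2 then 0 else 1)"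
proof -
  have "(\<lambda>v. vec_last v n2) ` X = {0\<^sub>v n2} \<longleftrightarrow> X \<subseteq> left_summand n1 n2"
    using vsubspace_carrier[OF assms] vsubspace_zero[OF vsubspace_vec_last[OF assms]]
    by (auto simp: left_summand_def)
  then show ?thesis using vsdim_eq_0_iff[OF vsubspace_vec_last[OF assms]] by auto
qed

text \<open>The closed form of the rank function of the direct sum.\<close>
definition direct_sum_rank :: "nat \<Rightarrow> nat \<Rightarrow> 'a::field vec set \<Rightarrow> nat" where
  "direct_sum_rank n1 n2 V =
     (if V = {0\<^sub>v (n1 + n2)} then 0
      else if vsdim (n1 + n2) V = 1 \<or> V \<subseteq> left_summand n1 n2 \<or> V \<subseteq> right_summand n1 n2 then 1
      else 2)"

lemma direct_sum_rank_le_vsdim: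
  fixes V :: "'a::{field,finite} vec set"
  assumes "vsubspace (n1 + n2) V"
  shows "direct_sum_rank n1 n2 V \<le> vsdim (n1 + n2) V"
  using vsdim_eq_0_iff[OF assms] by (auto simp: direct_sum_rank_def)

lemma direct_sum_rank_mono:
  fixes U V :: "'a::{field,finite} vec set"
  assumes U: "vsubspace (n1 + n2) U" and V: "vsubspace (n1 + n2) V" and "U \<subseteq> V"
  shows "direct_sum_rank n1 n2 U \<le> direct_sum_rank n1 n2 V"
proof -
  have "direct_sum_rank n1 n2 U \<le> vsdim (n1 + n2) U" by (rule direct_sum_rank_le_vsdim[OF U])
  moreover have "vsdim (n1 + n2) U \<le> vsdim (n1 + n2) V" by (rule vsdim_mono[OF assms])
  ultimately show ?thesis
    using vsubspace_zero[OF U] assms(3) by (auto simp: direct_sum_rank_def split: if_splits)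
qed

lemma finite_carrier_vec: "finite (carrier_vec n :: 'a::finite vec set)"
proof (rule finite_subset)
  show "carrier_vec n \<subseteq> vec_of_list ` {xs :: 'a list. set xs \<subseteq> UNIV \<and> length xs = n}"
  proof
    fix v :: "'a vec" assume "v \<in> carrier_vec n"
    then show "v \<in> vec_of_list ` {xs :: 'a list. set xs \<subseteq> UNIV \<and> length xs = n}"
      by (intro image_eqI[of _ _ "list_of_vec v"]) (auto simp: vec_list)
  qed
qed (intro finite_imageI finite_lists_length_eq finite)

text \<open>The rank-one rank of a projection of $X$ is 0 or 1, and it is 0 exactly when $X$ lies in the other
  summand. So $\rho_1'(X) + \rho_2'(X)$ is 0 for $X = 0$, it is 1 for other $X$ inside a summand, and it is 2
  for all remaining $X$. The minimum is attained at $X = 0$ if \<open>V\<close> is a line, and at $X = V$ otherwise; a proper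
  subspace inside a summand may save one in rank, but its dimension is smaller by at least one.\<close>
lemma rk_direct_sum_uniform_one:
  fixes V :: "'a::{field,finite} vec set"
  assumes V: "vsubspace (n1 + n2) V"
  shows "rk (qm_direct_sum (uniform_qmatroid 1 n1) (uniform_qmatroid 1 n2)) V = int (direct_sum_rank n1 n2 V)"
proof -
  let ?d = "vsdim (n1 + n2)" and ?L = "left_summand n1 n2 :: 'a vec set"
    and ?R = "right_summand n1 n2 :: 'a vec set" and ?zero = "{0\<^sub>v (n1 + n2) :: 'a vec}"
  define w :: "'a vec set \<Rightarrow> int" where "w X = (if X \<subseteq> ?R then 0 else 1) + (if X \<subseteq> ?L then 0 else 1)" for X
  define \<S> where "\<S> = {X. vsubspace (n1 + n2) X \<and> X \<subseteq> V}"
  have "finite V" using finite_carrier_vec vsubspace_carrier[OF V] by (rule finite_subset[rotated])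
  then have fin: "finite \<S>" unfolding \<S>_def by (rule finite_subset[rotated, OF finite_Pow_iff[THEN iffD2]]) auto
  have w_zero: "w ?zero = 0"
    unfolding w_def using vsubspace_zero[OF vsubspace_left_summand] vsubspace_zero[OF vsubspace_right_summand] by auto
  have LR: "X \<subseteq> ?zero" if "X \<subseteq> ?L" "X \<subseteq> ?R" for X
    using that left_Int_right_summand[of n1 n2, where 'a='a] by blast
  have trivial_or: "X = ?zero \<or> \<not> (X \<subseteq> ?L \<and> X \<subseteq> ?R)" if "vsubspace (n1 + n2) X" for X
    using LR vsubspace_zero[OF that] by blast
  have "rk (qm_direct_sum (uniform_qmatroid 1 n1) (uniform_qmatroid 1 n2)) V
      = int (?d V) + (MIN X\<in>\<S>. w X - int (?d X))"
  proof -
    have "(\<lambda>X. int (min 1 (vsdim n1 ((\<lambda>v. vec_first v n1) ` X))) + int (min 1 (vsdim n2 ((\<lambda>v. vec_last v n2) ` X))) - int (?d X)) ` \<S>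
        = (\<lambda>X. w X - int (?d X)) ` \<S>"
    proof (rule image_cong)
      fix X assume "X \<in> \<S>"
      then have X: "vsubspace (n1 + n2) X" by (simp add: \<S>_def)
      show "int (min 1 (vsdim n1 ((\<lambda>v. vec_first v n1) ` X))) + int (min 1 (vsdim n2 ((\<lambda>v. vec_last v n2) ` X))) - int (?d X)
          = w X - int (?d X)"
        unfolding rank_one_rank_of_first_projection[OF X] rank_one_rank_of_last_projection[OF X] w_def by simp
    qed simp
    then show ?thesis by (simp add: qm_direct_sum_def uniform_qmatroid_def \<S>_def Let_def)
  qed
  also have "(MIN X\<in>\<S>. w X - int (?d X)) = int (direct_sum_rank n1 n2 V) - int (?d V)"
  proof (rule Min_eqI)
    show "finite ((\<lambda>X. w X - int (?d X)) ` \<S>)" using fin by simp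
  next
    fix y assume "y \<in> (\<lambda>X. w X - int (?d X)) ` \<S>"
    then obtain X where X: "vsubspace (n1 + n2) X" "X \<subseteq> V" and y: "y = w X - int (?d X)"
      unfolding \<S>_def by blast
    have le: "?d X \<le> ?d V" and lt: "X \<noteq> V \<Longrightarrow> ?d X < ?d V"
      using vsdim_mono[OF X(1) V X(2)] vsdim_strict_mono[OF X(1) V] X(2) by auto
    show "int (direct_sum_rank n1 n2 V) - int (?d V) \<le> y"
    proof (cases "X = ?zero")
      case True
      then show ?thesis
        using y w_zero direct_sum_rank_le_vsdim[OF V] vsdim_trivial[of "n1 + n2", where 'a='a] by simp
    next
      case False
      then have "w X = 1 \<and> (X \<subseteq> ?L \<or> X \<subseteq> ?R) \<or> w X = 2"
        using trivial_or[OF X(1)] unfolding w_def by auto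
      then show ?thesis
      proof
        assume w: "w X = 2"
        have "direct_sum_rank n1 n2 V \<le> 2" by (simp add: direct_sum_rank_def)
        then show ?thesis using y w le by simp
      next
        assume w: "w X = 1 \<and> (X \<subseteq> ?L \<or> X \<subseteq> ?R)"
        show ?thesis
        proof (cases "X = V")
          case True
          with w have "direct_sum_rank n1 n2 V \<le> 1" by (auto simp: direct_sum_rank_def)
          then show ?thesis using y w le by simp
        next
          case False
          have "direct_sum_rank n1 n2 V \<le> 2" by (simp add: direct_sum_rank_def)
          then show ?thesis using y w lt[OF False] by simp
        qed
      qed
    qed
  next
    have VS: "V \<in> \<S>" using V by (simp add: \<S>_def)
    have zS: "?zero \<in> \<S>" using vsubspace_zero[OF V] vsubspace_trivial by (simp add: \<S>_def)
    show "int (direct_sum_rank n1 n2 V) - int (?d V) \<in> (\<lambda>X. w X - int (?d X)) ` \<S>"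
    proof (cases "V \<noteq> ?zero \<and> ?d V = 1")
      case True
      then have "direct_sum_rank n1 n2 V = 1" by (simp add: direct_sum_rank_def)
      with True show ?thesis
        by (intro image_eqI[OF _ zS]) (simp add: w_zero vsdim_trivial)
    next
      case False
      have "int (direct_sum_rank n1 n2 V) = w V"
      proof (cases "V = ?zero")
        case True
        then show ?thesis using w_zero by (simp add: direct_sum_rank_def)
      next
        case V0: False
        with False trivial_or[OF V] show ?thesis by (auto simp: direct_sum_rank_def w_def)
      qed
      then show ?thesis by (intro image_eqI[OF _ VS]) simp
    qed
  qed
  finally show ?thesis by simp
qed

text \<open>Only spaces $A, B$ of rank 1 that meet nontrivially and do not contain each other need an argument. Neither is
  a line, so each lies in a summand. As the summands meet in 0 it is the same one, and it contains
  $A + B$ as well.\<close>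
lemma direct_sum_rank_submodular:
  fixes A B :: "'a::{field,finite} vec set"
  assumes A: "vsubspace (n1 + n2) A" and B: "vsubspace (n1 + n2) B"
  shows "direct_sum_rank n1 n2 (vsum (n1 + n2) A B) + direct_sum_rank n1 n2 (A \<inter> B)
    \<le> direct_sum_rank n1 n2 A + direct_sum_rank n1 n2 B"
proof -
  interpret V: vec_space "TYPE('a)" "n1 + n2" .
  let ?S = "vsum (n1 + n2) A B" and ?r = "direct_sum_rank n1 n2 :: 'a vec set \<Rightarrow> nat"
  have S: "vsubspace (n1 + n2) ?S" by (rule V.sum_is_subspace[OF A B])
  have S_le: "?S \<subseteq> W" if "vsubspace (n1 + n2) W" "A \<subseteq> W" "B \<subseteq> W" for W
    using V.vsum_is_minimal[OF A B that(1)] that by blast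
  have I: "vsubspace (n1 + n2) (A \<inter> B)" by (rule vsubspace_Int[OF A B])
  have r_le: "?r U \<le> 2" for U by (simp add: direct_sum_rank_def)
  have r_pos: "?r U \<ge> 1" if "U \<noteq> {0\<^sub>v (n1 + n2)}" for U using that by (simp add: direct_sum_rank_def)
  have r_1: "U \<subseteq> left_summand n1 n2 \<or> U \<subseteq> right_summand n1 n2"
    if "?r U = 1" "vsdim (n1 + n2) U \<noteq> 1" for U
  proof (rule ccontr)
    assume "\<not> (U \<subseteq> left_summand n1 n2 \<or> U \<subseteq> right_summand n1 n2)"
    then have "?r U = 0 \<or> ?r U = 2" using that(2) by (simp add: direct_sum_rank_def)
    then show False using that(1) by simp
  qed
  have mono_A: "?r (A \<inter> B) \<le> ?r A" and mono_B: "?r (A \<inter> B) \<le> ?r B"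
    by (rule direct_sum_rank_mono[OF I A] direct_sum_rank_mono[OF I B], simp)+
  consider "A \<subseteq> B" | "B \<subseteq> A" | "\<not> A \<subseteq> B" "\<not> B \<subseteq> A" by blast
  then show ?thesis
  proof cases
    case 1
    then have "A \<inter> B = A" "?r ?S \<le> ?r B" using direct_sum_rank_mono[OF S B S_le[OF B]] by auto
    then show ?thesis by simp
  next
    case 2
    then have "A \<inter> B = B" "?r ?S \<le> ?r A" using direct_sum_rank_mono[OF S A S_le[OF A]] by auto
    then show ?thesis by simp
  next
    case 3
    then have nz: "A \<noteq> {0\<^sub>v (n1 + n2)}" "B \<noteq> {0\<^sub>v (n1 + n2)}"
      using vsubspace_zero[OF A] vsubspace_zero[OF B] by auto
    note pos = r_pos[OF nz(1)] r_pos[OF nz(2)]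
    show ?thesis
    proof (cases "?r A = 1 \<and> ?r B = 1 \<and> A \<inter> B \<noteq> {0\<^sub>v (n1 + n2)}")
      case False
      then consider "?r A = 2" | "?r B = 2" | "A \<inter> B = {0\<^sub>v (n1 + n2)}" "?r A = 1" "?r B = 1"
        using pos r_le[of A] r_le[of B] by linarith
      then show ?thesis
      proof cases
        case 3
        then have "?r (A \<inter> B) = 0" by (simp add: direct_sum_rank_def)
        with 3 show ?thesis using r_le[of ?S] by linarith
      qed (use r_le[of ?S] mono_A mono_B in linarith)+
    next
      case True
      have "A \<inter> B \<subset> A" "A \<inter> B \<subset> B" using 3 by auto
      then have "vsdim (n1 + n2) A \<noteq> 1" "vsdim (n1 + n2) B \<noteq> 1"
        using vsdim_strict_mono[OF I A] vsdim_strict_mono[OF I B] vsdim_eq_0_iff[OF I] True by auto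
      then have "A \<subseteq> left_summand n1 n2 \<or> A \<subseteq> right_summand n1 n2"
        "B \<subseteq> left_summand n1 n2 \<or> B \<subseteq> right_summand n1 n2"
        using r_1 True by blast+
      moreover have "\<not> A \<inter> B \<subseteq> left_summand n1 n2 \<inter> right_summand n1 n2"
        using True vsubspace_zero[OF I] unfolding left_Int_right_summand by blast
      ultimately have "A \<subseteq> left_summand n1 n2 \<and> B \<subseteq> left_summand n1 n2 \<or>
          A \<subseteq> right_summand n1 n2 \<and> B \<subseteq> right_summand n1 n2" by blast
      then have "?S \<subseteq> left_summand n1 n2 \<or> ?S \<subseteq> right_summand n1 n2"
        using S_le[OF vsubspace_left_summand] S_le[OF vsubspace_right_summand] by blast
      then have "?r ?S \<le> 1" by (simp add: direct_sum_rank_def)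
      then show ?thesis using True mono_A by simp
    qed
  qed
qed

lemma is_qmatroid_direct_sum_uniform_one:
  "is_qmatroid (qm_direct_sum (uniform_qmatroid 1 n1) (uniform_qmatroid 1 n2 :: 'a::{field,finite} qmatroid))"
proof -
  interpret V: vec_space "TYPE('a)" "n1 + n2" .
  have dim: "ground_dim (qm_direct_sum (uniform_qmatroid 1 n1) (uniform_qmatroid 1 n2 :: 'a qmatroid)) = n1 + n2"
    by (simp add: qm_direct_sum_def uniform_qmatroid_def Let_def)
  show ?thesis
    unfolding is_qmatroid_def Let_def dim
  proof (intro conjI allI impI)
    fix A :: "'a vec set" assume A: "vsubspace (n1 + n2) A"
    show "0 \<le> rk (qm_direct_sum (uniform_qmatroid 1 n1) (uniform_qmatroid 1 n2)) A"
      "rk (qm_direct_sum (uniform_qmatroid 1 n1) (uniform_qmatroid 1 n2)) A \<le> int (vsdim (n1 + n2) A)"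
      unfolding rk_direct_sum_uniform_one[OF A] using direct_sum_rank_le_vsdim[OF A] by simp_all
  next
    fix A B :: "'a vec set" assume AB: "vsubspace (n1 + n2) A" "vsubspace (n1 + n2) B" "A \<subseteq> B"
    show "rk (qm_direct_sum (uniform_qmatroid 1 n1) (uniform_qmatroid 1 n2)) A
      \<le> rk (qm_direct_sum (uniform_qmatroid 1 n1) (uniform_qmatroid 1 n2)) B"
      unfolding rk_direct_sum_uniform_one[OF AB(1)] rk_direct_sum_uniform_one[OF AB(2)]
      using direct_sum_rank_mono[OF AB] by simp
  next
    fix A B :: "'a vec set" assume AB: "vsubspace (n1 + n2) A" "vsubspace (n1 + n2) B"
    show "rk (qm_direct_sum (uniform_qmatroid 1 n1) (uniform_qmatroid 1 n2)) (vsum (n1 + n2) A B)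
        + rk (qm_direct_sum (uniform_qmatroid 1 n1) (uniform_qmatroid 1 n2)) (A \<inter> B)
      \<le> rk (qm_direct_sum (uniform_qmatroid 1 n1) (uniform_qmatroid 1 n2)) A
        + rk (qm_direct_sum (uniform_qmatroid 1 n1) (uniform_qmatroid 1 n2)) B"
      unfolding rk_direct_sum_uniform_one[OF AB(1)] rk_direct_sum_uniform_one[OF AB(2)]
        rk_direct_sum_uniform_one[OF vsubspace_Int[OF AB]]
        rk_direct_sum_uniform_one[OF V.sum_is_subspace[OF AB]]
      using direct_sum_rank_submodular[OF AB] by (simp flip: of_nat_add)
  qed
qed

section \<open>Ranks of matrices with two rows\<close>

lemma rank_eq_vsdim_span:
  "vec_space.rank n M = vsdim n (module.span class_ring (module_vec TYPE('b::field) n) (set (cols M)))"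
  unfolding vec_space.rank_def vsdim_def ..

lemma
  fixes M :: "'b::{field,finite} mat"
  assumes M: "M \<in> carrier_mat 2 k"
  shows rank_two_rows_pos: "j < k \<Longrightarrow> col M j \<noteq> 0\<^sub>v 2 \<Longrightarrow> vec_space.rank 2 M \<ge> 1"
    and rank_two_rows_eq_2: "i < k \<Longrightarrow> j < k \<Longrightarrow> M $$ (0, i) * M $$ (1, j) \<noteq> M $$ (0, j) * M $$ (1, i) \<Longrightarrow>
      vec_space.rank 2 M = 2"
    and rank_two_rows_zero_row: "r < 2 \<Longrightarrow> (\<And>j. j < k \<Longrightarrow> M $$ (r, j) = 0) \<Longrightarrow> vec_space.rank 2 M \<le> 1"
proof -
  interpret V: vec_space "TYPE('b)" 2 .
  let ?S = "V.span (set (cols M))"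
  have cols: "set (cols M) \<subseteq> carrier_vec 2" using cols_dim[of M] M by simp
  have S: "vsubspace 2 ?S" by (rule vsubspace_span[OF cols])
  have SC: "?S \<subseteq> carrier_vec 2" by (rule vsubspace_carrier[OF S])
  have col_in: "col M j \<in> ?S" if "j < k" for j
    using V.in_own_span[of "set (cols M)"] cols that M by (auto simp: cols_def)
  have le: "V.rank M \<le> 2"
    unfolding rank_eq_vsdim_span using vsdim_mono[OF S vsubspace_full SC] by (simp add: vsdim_full)
  show "V.rank M \<ge> 1" if "j < k" "col M j \<noteq> 0\<^sub>v 2"
  proof -
    have "?S \<noteq> {0\<^sub>v 2}" using col_in that by blast
    then show ?thesis unfolding rank_eq_vsdim_span using vsdim_eq_0_iff[OF S] by simp
  qed
  show "V.rank M = 2" if ij: "i < k" "j < k" and det: "M $$ (0, i) * M $$ (1, j) \<noteq> M $$ (0, j) * M $$ (1, i)"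
  proof -
    let ?l = "{v \<in> carrier_vec 2. M $$ (0, i) * v $ 1 = v $ 0 * M $$ (1, i)}"
    have l: "vsubspace 2 ?l" by (rule vsubspaceI) (auto simp: algebra_simps)
    note I = vsubspace_Int[OF S l]
    have "col M i \<in> ?l" using ij M by auto
    moreover have "col M i \<noteq> 0\<^sub>v 2"
    proof
      assume "col M i = 0\<^sub>v 2"
      then have "col M i $ 0 = 0" "col M i $ 1 = 0" by simp_all
      then show False using det ij M by simp
    qed
    ultimately have "?S \<inter> ?l \<noteq> {0\<^sub>v 2}" using col_in[OF ij(1)] by blast
    then have "vsdim 2 (?S \<inter> ?l) \<noteq> 0" using vsdim_eq_0_iff[OF I] by simp
    moreover have "col M j \<notin> ?l" using ij M det by simp
    then have "?S \<inter> ?l \<subset> ?S" using col_in[OF ij(2)] by blast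
    then have "vsdim 2 (?S \<inter> ?l) < vsdim 2 ?S" by (rule vsdim_strict_mono[OF I S])
    ultimately show ?thesis using le unfolding rank_eq_vsdim_span by linarith
  qed
  show "V.rank M \<le> 1" if r: "r < 2" and zero: "\<And>j. j < k \<Longrightarrow> M $$ (r, j) = 0"
  proof -
    let ?l = "{v \<in> carrier_vec 2. v $ r = (0 :: 'b)}"
    have l: "vsubspace 2 ?l" by (rule vsubspaceI) (use r in auto)
    have "set (cols M) \<subseteq> ?l" using zero M r by (auto simp: cols_def)
    then have "?S \<subseteq> ?l" by (rule V.span_is_subset[OF _ subspace.submod[OF l]])
    then have "vsdim 2 ?S \<le> vsdim 2 ?l" by (rule vsdim_mono[OF S l])
    also have "unit_vec 2 r \<notin> ?l" using r by simp
    then have "?l \<subset> carrier_vec 2" using unit_vec_carrier[of 2 r] by blast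
    then have "vsdim 2 ?l < 2" using vsdim_strict_mono[OF l vsubspace_full] by (simp add: vsdim_full)
    finally show ?thesis unfolding rank_eq_vsdim_span by simp
  qed
qed

context finite_field_extension
begin

section \<open>The representing matrix\<close>

definition block_matrix :: "nat \<Rightarrow> nat \<Rightarrow> (nat \<Rightarrow> 'b) \<Rightarrow> (nat \<Rightarrow> 'b) \<Rightarrow> 'b mat" where
  "block_matrix n1 n2 \<alpha> \<beta> = mat 2 (n1 + n2)
     (\<lambda>(r, c). if r = 0 then (if c < n1 then \<alpha> c else 0) else (if c < n1 then 0 else \<beta> (c - n1)))"

lemma block_matrix_mult_vec:
  assumes "u \<in> carrier_vec (n1 + n2)"
  shows "(block_matrix n1 n2 \<alpha> \<beta> *\<^sub>v map_vec \<iota> u) $ 0 = (\<Sum>i<n1. \<iota> (u $ i) * \<alpha> i)"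
    and "(block_matrix n1 n2 \<alpha> \<beta> *\<^sub>v map_vec \<iota> u) $ 1 = (\<Sum>j<n2. \<iota> (u $ (n1 + j)) * \<beta> j)"
proof -
  have "(block_matrix n1 n2 \<alpha> \<beta> *\<^sub>v map_vec \<iota> u) $ 0
      = (\<Sum>i<n1 + n2. if i < n1 then \<iota> (u $ i) * \<alpha> i else 0)"
    using assms by (simp add: block_matrix_def scalar_prod_def atLeast0LessThan)
      (intro sum.cong; simp)
  also have "\<dots> = (\<Sum>i<n1. \<iota> (u $ i) * \<alpha> i)"
    by (intro sum.mono_neutral_cong_right) auto
  finally show "(block_matrix n1 n2 \<alpha> \<beta> *\<^sub>v map_vec \<iota> u) $ 0 = (\<Sum>i<n1. \<iota> (u $ i) * \<alpha> i)" .
  have "(block_matrix n1 n2 \<alpha> \<beta> *\<^sub>v map_vec \<iota> u) $ 1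
      = (\<Sum>i<n1 + n2. if i < n1 then 0 else \<iota> (u $ i) * \<beta> (i - n1))"
    using assms by (simp add: block_matrix_def scalar_prod_def atLeast0LessThan)
      (intro sum.cong; simp)
  also have "\<dots> = (\<Sum>j<n2. \<iota> (u $ (n1 + j)) * \<beta> j)"
  proof -
    have "(\<Sum>i<n1 + n2. if i < n1 then 0 else \<iota> (u $ i) * \<beta> (i - n1))
        = (\<Sum>i\<in>{n1..<n1 + n2}. \<iota> (u $ i) * \<beta> (i - n1))"
      by (intro sum.mono_neutral_cong_right) auto
    also have "\<dots> = (\<Sum>j<n2. \<iota> (u $ (n1 + j)) * \<beta> j)"
      by (rule sum.reindex_bij_witness[of _ "\<lambda>j. n1 + j" "\<lambda>i. i - n1"]) auto
    finally show ?thesis .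
  qed
  finally show "(block_matrix n1 n2 \<alpha> \<beta> *\<^sub>v map_vec \<iota> u) $ 1 = (\<Sum>j<n2. \<iota> (u $ (n1 + j)) * \<beta> j)" .
qed

lemma left_summand_iff:
  assumes "independent_family n2 \<beta>" "u \<in> carrier_vec (n1 + n2)"
  shows "(\<Sum>j<n2. \<iota> (u $ (n1 + j)) * \<beta> j) = 0 \<longleftrightarrow> u \<in> left_summand n1 n2"
proof -
  have iff: "u \<in> left_summand n1 n2 \<longleftrightarrow> (\<forall>j<n2. u $ (n1 + j) = 0)"
    using assms(2) by (auto simp: left_summand_def vec_last_def vec_eq_iff)
  have "(\<forall>j<n2. u $ (n1 + j) = 0)" if "(\<Sum>j<n2. \<iota> (u $ (n1 + j)) * \<beta> j) = 0"
    using assms(1)[unfolded independent_family_def, THEN spec[of _ "\<lambda>j. u $ (n1 + j)"]] that by blast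
  moreover have "(\<Sum>j<n2. \<iota> (u $ (n1 + j)) * \<beta> j) = 0" if "(\<forall>j<n2. u $ (n1 + j) = 0)"
  proof (rule sum.neutral, rule ballI)
    fix j assume "j \<in> {..<n2}"
    then have "u $ (n1 + j) = 0" using that by blast
    then show "\<iota> (u $ (n1 + j)) * \<beta> j = 0" by (simp only: hom_zero mult_zero_left)
  qed
  ultimately show ?thesis unfolding iff by (rule iffI)
qed

lemma right_summand_iff:
  assumes "independent_family n1 \<alpha>" "u \<in> carrier_vec (n1 + n2)"
  shows "(\<Sum>i<n1. \<iota> (u $ i) * \<alpha> i) = 0 \<longleftrightarrow> u \<in> right_summand n1 n2"
proof -
  have iff: "u \<in> right_summand n1 n2 \<longleftrightarrow> (\<forall>i<n1. u $ i = 0)"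
    using assms(2) by (auto simp: right_summand_def vec_first_def vec_eq_iff)
  have "(\<forall>i<n1. u $ i = 0)" if "(\<Sum>i<n1. \<iota> (u $ i) * \<alpha> i) = 0"
    using assms(1)[unfolded independent_family_def, THEN spec[of _ "\<lambda>i. u $ i"]] that by blast
  moreover have "(\<Sum>i<n1. \<iota> (u $ i) * \<alpha> i) = 0" if "(\<forall>i<n1. u $ i = 0)"
  proof (rule sum.neutral, rule ballI)
    fix i assume "i \<in> {..<n1}"
    then have "u $ i = 0" using that by blast
    then show "\<iota> (u $ i) * \<alpha> i = 0" by (simp only: hom_zero mult_zero_left)
  qed
  ultimately show ?thesis unfolding iff by (rule iffI)
qed

text \<open>The entries \<open>\<phi> u\<close>, \<open>\<psi> u\<close> are those of the image of \<open>u\<close> under the block matrix. If two images are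
  parallel over $K$ and the first has no zero entry, then the ratio of their entries is a common ratio of
  the two spans and lies in $F$, and injectivity of the block matrix on $F^{n_1+n_2}$ lifts the proportionality to \<open>u\<close> and \<open>v\<close>.\<close>
lemma proportional_images_imp_proportional:
  fixes n1 n2 :: nat and \<alpha> \<beta> :: "nat \<Rightarrow> 'b"
  defines "\<phi> \<equiv> \<lambda>u. \<Sum>i<n1. \<iota> (u $ i) * \<alpha> i" and "\<psi> \<equiv> \<lambda>u. \<Sum>j<n2. \<iota> (u $ (n1 + j)) * \<beta> j"
  assumes \<alpha>: "independent_family n1 \<alpha>" and \<beta>: "independent_family n2 \<beta>"
    and disj: "ratio_disjoint (family_span n1 \<alpha>) (family_span n2 \<beta>)"
    and u: "u \<in> carrier_vec (n1 + n2)" and v: "v \<in> carrier_vec (n1 + n2)"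
    and det: "\<phi> u * \<psi> v = \<phi> v * \<psi> u" and nz: "\<phi> u \<noteq> 0" "\<psi> u \<noteq> 0"
  shows "\<exists>c. v = c \<cdot>\<^sub>v u"
proof -
  have "\<exists>c. \<phi> v = \<iota> c * \<phi> u \<and> \<psi> v = \<iota> c * \<psi> u"
  proof (cases "\<phi> v = 0 \<or> \<psi> v = 0")
    case True
    then have "\<phi> v = 0 \<and> \<psi> v = 0" using det nz by auto
    then show ?thesis by (intro exI[of _ 0]) simp
  next
    case False
    have "\<phi> w \<in> family_span n1 \<alpha>" "\<psi> w \<in> family_span n2 \<beta>" for w
      unfolding \<phi>_def \<psi>_def family_span_def by (intro rangeI)+
    then have "\<phi> v / \<phi> u \<in> range \<iota>"
      using disj False nz det unfolding ratio_disjoint_def by metis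
    then obtain c where "\<phi> v / \<phi> u = \<iota> c" by blast
    then have c: "\<phi> v = \<iota> c * \<phi> u" using nz by (simp add: divide_eq_eq)
    then have "\<phi> u * \<psi> v = \<phi> u * (\<iota> c * \<psi> u)" using det by (simp add: ac_simps)
    with c nz show ?thesis by auto
  qed
  then obtain c where c: "\<phi> v = \<iota> c * \<phi> u" "\<psi> v = \<iota> c * \<psi> u" by blast
  define w where "w = v + (- c) \<cdot>\<^sub>v u"
  have w: "w \<in> carrier_vec (n1 + n2)" using u v by (simp add: w_def)
  have wi: "w $ i = v $ i - c * u $ i" if "i < n1 + n2" for i
    using u v that by (simp add: w_def)
  have "\<phi> w = \<phi> v - \<iota> c * \<phi> u" "\<psi> w = \<psi> v - \<iota> c * \<psi> u"
    by (simp_all add: \<phi>_def \<psi>_def wi hom_distribs left_diff_distrib sum_subtractf sum_distrib_left mult.assoc)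
  then have "\<phi> w = 0" "\<psi> w = 0" using c by simp_all
  then have "w \<in> left_summand n1 n2 \<inter> right_summand n1 n2"
    using left_summand_iff[OF \<beta> w] right_summand_iff[OF \<alpha> w] by (simp add: \<phi>_def \<psi>_def)
  then have w0: "w = 0\<^sub>v (n1 + n2)" unfolding left_Int_right_summand by simp
  have "v = c \<cdot>\<^sub>v u"
  proof (rule eq_vecI)
    fix i assume "i < dim_vec (c \<cdot>\<^sub>v u)"
    then show "v $ i = (c \<cdot>\<^sub>v u) $ i" using wi[of i] u by (simp add: w0)
  qed (use u v in simp)
  then show ?thesis by blast
qed

text \<open>The columns of the product are the images of the basis vectors of \<open>U\<close>. The only case that needs the
  ratio condition is a space \<open>U\<close> of rank 2, where two columns with nonzero minor have to be found. Some basis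
  vector \<open>a\<close> lies outside the left summand. If \<open>a\<close> lies in the right one, any basis vector outside the right
  summand completes it. If \<open>a\<close> lies in neither and all minors with \<open>a\<close> vanished, then all basis vectors would be
  multiples of \<open>a\<close> and \<open>U\<close> would be a line.\<close>
lemma rank_block_matrix_eq_direct_sum_rank:
  assumes \<alpha>: "independent_family n1 \<alpha>" and \<beta>: "independent_family n2 \<beta>"
    and disj: "ratio_disjoint (family_span n1 \<alpha>) (family_span n2 \<beta>)"
    and U: "vsubspace (n1 + n2) U" and A: "is_basis_matrix (n1 + n2) U A"
  shows "vec_space.rank 2 (block_matrix n1 n2 \<alpha> \<beta> * map_mat \<iota> A) = direct_sum_rank n1 n2 U"
proof -
  interpret V: vec_space "TYPE('a)" "n1 + n2" .
  define d where "d = vsdim (n1 + n2) U"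
  define \<phi> where "\<phi> u = (\<Sum>i<n1. \<iota> (u $ i) * \<alpha> i)" for u
  define \<psi> where "\<psi> u = (\<Sum>j<n2. \<iota> (u $ (n1 + j)) * \<beta> j)" for u
  define M where "M = block_matrix n1 n2 \<alpha> \<beta> * map_mat \<iota> A"
  note B = basis_matrixD[OF U A, folded d_def]
  have M: "M \<in> carrier_mat 2 d"
    unfolding M_def by (rule mult_carrier_mat[of _ 2 "n1 + n2"]) (use B(1) in \<open>simp_all add: block_matrix_def\<close>)
  have colU: "col A j \<in> U" if "j < d" for j
    using B(1,2) that by (metis carrier_matD(2) cols_length cols_nth nth_mem subsetD)
  have colV: "col A j \<in> carrier_vec (n1 + n2)" if "j < d" for j
    using colU[OF that] vsubspace_carrier[OF U] by blast
  have M0: "M $$ (0, j) = \<phi> (col A j)" and M1: "M $$ (1, j) = \<psi> (col A j)" if "j < d" for j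
  proof -
    have "col M j = block_matrix n1 n2 \<alpha> \<beta> *\<^sub>v map_vec \<iota> (col A j)"
      unfolding M_def using that B(1)
      by (subst col_mult2[of _ 2 "n1 + n2" _ d]) (auto simp: block_matrix_def col_map_mat)
    then have "col M j $ 0 = \<phi> (col A j)" "col M j $ 1 = \<psi> (col A j)"
      using block_matrix_mult_vec[OF colV[OF that]] by (simp_all add: \<phi>_def \<psi>_def)
    then show "M $$ (0, j) = \<phi> (col A j)" "M $$ (1, j) = \<psi> (col A j)" using M that by simp_all
  qed
  \<comment> \<open>The first entry sees only the left coordinates, so it vanishes on the right summand.\<close>
  have \<phi>0: "\<phi> (col A j) = 0 \<longleftrightarrow> col A j \<in> right_summand n1 n2"
    and \<psi>0: "\<psi> (col A j) = 0 \<longleftrightarrow> col A j \<in> left_summand n1 n2" if "j < d" for j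
    using left_summand_iff[OF \<beta> colV[OF that]] right_summand_iff[OF \<alpha> colV[OF that]]
    by (simp_all add: \<phi>_def \<psi>_def)
  have col_notin: "\<exists>j<d. col A j \<notin> W" if "vsubspace (n1 + n2) W" "\<not> U \<subseteq> W" for W
  proof (rule ccontr)
    assume "\<not> (\<exists>j<d. col A j \<notin> W)"
    then have "set (cols A) \<subseteq> W" using B(1) by (auto simp: cols_def)
    then have "V.span (set (cols A)) \<subseteq> W" by (rule V.span_is_subset[OF _ subspace.submod[OF that(1)]])
    then show False using B(3) that(2) by simp
  qed
  consider "U = {0\<^sub>v (n1 + n2)}"
    | "U \<noteq> {0\<^sub>v (n1 + n2)}" "d = 1 \<or> U \<subseteq> left_summand n1 n2 \<or> U \<subseteq> right_summand n1 n2"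
    | "U \<noteq> {0\<^sub>v (n1 + n2)}" "d \<noteq> 1" "\<not> U \<subseteq> left_summand n1 n2" "\<not> U \<subseteq> right_summand n1 n2"
    by blast
  then have "vec_space.rank 2 M = direct_sum_rank n1 n2 U"
  proof cases
    case 1
    then have "d = 0" using vsdim_eq_0_iff[OF U] by (simp add: d_def)
    then show ?thesis using vec_space.rank_le_nc[OF M] 1 by (simp add: direct_sum_rank_def)
  next
    case 2
    then have "d > 0" using vsdim_eq_0_iff[OF U] by (simp add: d_def)
    have "col M 0 \<noteq> 0\<^sub>v 2"
    proof
      assume "col M 0 = 0\<^sub>v 2"
      then have "col M 0 $ 0 = 0" "col M 0 $ 1 = 0" by simp_all
      then have "\<phi> (col A 0) = 0" "\<psi> (col A 0) = 0"
        using M0[OF \<open>d > 0\<close>] M1[OF \<open>d > 0\<close>] M \<open>d > 0\<close> by simp_all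
      then have "col A 0 \<in> left_summand n1 n2 \<inter> right_summand n1 n2"
        using \<phi>0[OF \<open>d > 0\<close>] \<psi>0[OF \<open>d > 0\<close>] by simp
      then have "col A 0 = 0\<^sub>v (n1 + n2)" unfolding left_Int_right_summand by simp
      moreover have "col A 0 \<in> set (cols A)" using B(1) \<open>d > 0\<close> by (auto simp: cols_def)
      moreover have "set (cols A) \<subseteq> carrier_vec (n1 + n2)" using B(2) vsubspace_carrier[OF U] by blast
      ultimately show False using V.vs_zero_lin_dep B(4) by simp
    qed
    then have "vec_space.rank 2 M \<ge> 1" using rank_two_rows_pos[OF M \<open>d > 0\<close>] by simp
    moreover have "vec_space.rank 2 M \<le> 1"
      using 2(2)
    proof (elim disjE)
      assume "d = 1"
      then show ?thesis using vec_space.rank_le_nc[OF M] by simp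
    next
      assume "U \<subseteq> left_summand n1 n2"
      then have "M $$ (1, j) = 0" if "j < d" for j using M1[OF that] \<psi>0[OF that] colU[OF that] by auto
      then show ?thesis using rank_two_rows_zero_row[OF M, of 1] by simp
    next
      assume "U \<subseteq> right_summand n1 n2"
      then have "M $$ (0, j) = 0" if "j < d" for j using M0[OF that] \<phi>0[OF that] colU[OF that] by auto
      then show ?thesis using rank_two_rows_zero_row[OF M, of 0] by simp
    qed
    ultimately show ?thesis using 2 by (auto simp: direct_sum_rank_def d_def)
  next
    case 3
    obtain j where j: "j < d" "col A j \<notin> left_summand n1 n2"
      using col_notin[OF vsubspace_left_summand 3(3)] by blast
    have "\<exists>i<d. \<phi> (col A i) * \<psi> (col A j) \<noteq> \<phi> (col A j) * \<psi> (col A i)"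
    proof (cases "col A j \<in> right_summand n1 n2")
      case True
      obtain i where i: "i < d" "col A i \<notin> right_summand n1 n2"
        using col_notin[OF vsubspace_right_summand 3(4)] by blast
      have "\<phi> (col A i) \<noteq> 0" "\<phi> (col A j) = 0" "\<psi> (col A j) \<noteq> 0"
        using i True j \<phi>0[OF i(1)] \<phi>0[OF j(1)] \<psi>0[OF j(1)] by simp_all
      then show ?thesis using i(1) by (intro exI[of _ i]) simp
    next
      case False
      show ?thesis
      proof (rule ccontr)
        assume "\<not> ?thesis"
        then have det: "\<phi> (col A i) * \<psi> (col A j) = \<phi> (col A j) * \<psi> (col A i)" if "i < d" for i
          using that by blast
        have nz: "\<phi> (col A j) \<noteq> 0" "\<psi> (col A j) \<noteq> 0" using False j \<phi>0 \<psi>0 by simp_all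
        have "\<exists>c. col A i = c \<cdot>\<^sub>v col A j" if i: "i < d" for i
          by (rule proportional_images_imp_proportional[OF \<alpha> \<beta> disj colV[OF j(1)] colV[OF i]])
            (use det[OF i] nz in \<open>simp_all add: \<phi>_def \<psi>_def\<close>)
        then have "set (cols A) \<subseteq> V.span {col A j}"
          using B(1) V.smult_in_span[of "{col A j}" "col A j"] V.span_self[of "col A j"] colV[OF j(1)]
          by (fastforce simp: cols_def)
        then have "U \<subseteq> V.span {col A j}"
          using V.span_subsetI[of "{col A j}" "set (cols A)"] colV[OF j(1)] B(3) by simp
        then have "d \<le> card {col A j}"
          unfolding d_def by (intro vsdim_le_card[OF U]) (use colU[OF j(1)] in simp_all)
        then have "d \<le> 1" by simp
        moreover have "d \<noteq> 0" using j by simp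
        ultimately show False using 3(2) by simp
      qed
    qed
    then obtain i where "i < d" "M $$ (0, i) * M $$ (1, j) \<noteq> M $$ (0, j) * M $$ (1, i)"
      using M0 M1 j by metis
    then have "vec_space.rank 2 M = 2" using rank_two_rows_eq_2[OF M] j by blast
    then show ?thesis using 3 by (simp add: direct_sum_rank_def d_def)
  qed
  then show ?thesis by (simp add: M_def)
qed

lemma representable_if_ratio_disjoint_dims:
  assumes "ratio_disjoint_dims n1 n2" "n1 \<ge> 1" "n2 \<ge> 1"
  shows "representable_via \<iota> (qm_direct_sum (uniform_qmatroid 1 n1) (uniform_qmatroid 1 n2))"
proof -
  let ?D = "qm_direct_sum (uniform_qmatroid 1 n1) (uniform_qmatroid 1 n2) :: 'a qmatroid"
  obtain A B where AB: "K.subspace A" "K.subspace B" "q ^ n1 \<le> card A" "q ^ n2 \<le> card B" "ratio_disjoint A B"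
    using assms(1) unfolding ratio_disjoint_dims_def by blast
  obtain \<alpha> where \<alpha>: "independent_family n1 \<alpha>" "\<forall>i<n1. \<alpha> i \<in> A"
    using independent_family_exists[OF AB(3)] by blast
  obtain \<beta> where \<beta>: "independent_family n2 \<beta>" "\<forall>i<n2. \<beta> i \<in> B"
    using independent_family_exists[OF AB(4)] by blast
  have disj: "ratio_disjoint (family_span n1 \<alpha>) (family_span n2 \<beta>)"
    using AB(5) family_span_subset[OF AB(1)] family_span_subset[OF AB(2)] \<alpha>(2) \<beta>(2)
    unfolding ratio_disjoint_def by (meson subsetD)
  define G where "G = block_matrix n1 n2 \<alpha> \<beta>"
  have G: "G \<in> carrier_mat 2 (n1 + n2)" by (simp add: G_def block_matrix_def)
  have dim: "ground_dim ?D = n1 + n2" by (simp add: qm_direct_sum_def uniform_qmatroid_def Let_def)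
  have "rk ?D U = rk (matrix_qmatroid \<iota> G) U" if U: "vsubspace (n1 + n2) U" for U
  proof -
    have "is_basis_matrix (n1 + n2) U (SOME A. is_basis_matrix (n1 + n2) U A)"
      using basis_matrix_exists[OF U] by (rule someI_ex)
    from rank_block_matrix_eq_direct_sum_rank[OF \<alpha>(1) \<beta>(1) disj U this] show ?thesis
      using rk_direct_sum_uniform_one[OF U] G by (simp add: matrix_qmatroid_def G_def)
  qed
  moreover have "ground_dim (matrix_qmatroid \<iota> G) = n1 + n2" using G by (simp add: matrix_qmatroid_def)
  ultimately have eq: "qm_eq ?D (matrix_qmatroid \<iota> G)"
    unfolding qm_eq_def dim by (intro conjI allI impI) simp_all
  have nz: "\<alpha> 0 \<noteq> 0" "\<beta> 0 \<noteq> 0"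
  proof -
    have "\<gamma> 0 \<noteq> 0" if "independent_family n \<gamma>" "n \<ge> 1" for n \<gamma>
    proof
      assume "\<gamma> 0 = 0"
      then have "(\<Sum>i<n. \<iota> (if i = 0 then 1 else 0) * \<gamma> i) = 0" by (intro sum.neutral) auto
      then show False
        using that(1)[unfolded independent_family_def, THEN spec[of _ "\<lambda>i. if i = 0 then 1 else 0"]] that(2)
        by force
    qed
    then show "\<alpha> 0 \<noteq> 0" "\<beta> 0 \<noteq> 0" using \<alpha>(1) \<beta>(1) assms(2,3) by blast+
  qed
  have "vec_space.rank 2 G = 2"
  proof (rule rank_two_rows_eq_2[OF G])
    show "0 < n1 + n2" "n1 < n1 + n2" using assms by simp_all
    show "G $$ (0, 0) * G $$ (1, n1) \<noteq> G $$ (0, n1) * G $$ (1, 0)"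
      using assms(2,3) nz by (simp add: G_def block_matrix_def)
  qed
  moreover have "direct_sum_rank n1 n2 (carrier_vec (n1 + n2) :: 'a vec set) = 2"
  proof -
    have "unit_vec (n1 + n2) n1 \<notin> (left_summand n1 n2 :: 'a vec set)"
    proof
      assume "unit_vec (n1 + n2) n1 \<in> (left_summand n1 n2 :: 'a vec set)"
      then have "vec_last (unit_vec (n1 + n2) n1 :: 'a vec) n2 $ 0 = 0\<^sub>v n2 $ 0" by (simp add: left_summand_def)
      then show False using assms(3) by (simp add: vec_last_def)
    qed
    moreover have "unit_vec (n1 + n2) 0 \<notin> (right_summand n1 n2 :: 'a vec set)"
    proof
      assume "unit_vec (n1 + n2) 0 \<in> (right_summand n1 n2 :: 'a vec set)"
      then have "vec_first (unit_vec (n1 + n2) 0 :: 'a vec) n1 $ 0 = 0\<^sub>v n1 $ 0" by (simp add: right_summand_def)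
      then show False using assms(2) by (simp add: vec_first_def)
    qed
    ultimately have "\<not> carrier_vec (n1 + n2) \<subseteq> (left_summand n1 n2 :: 'a vec set)"
      "\<not> carrier_vec (n1 + n2) \<subseteq> (right_summand n1 n2 :: 'a vec set)"
      using unit_vec_carrier by blast+
    moreover from this(1) have "carrier_vec (n1 + n2) \<noteq> {0\<^sub>v (n1 + n2) :: 'a vec}"
      using vsubspace_zero[OF vsubspace_left_summand[of n1 n2, where 'a='a]] by auto
    ultimately show ?thesis using assms(2,3) by (simp add: direct_sum_rank_def vsdim_full)
  qed
  then have "qm_rank ?D = 2"
    unfolding qm_rank_def dim rk_direct_sum_uniform_one[OF vsubspace_full] by simp
  ultimately show ?thesis
    unfolding representable_via_def dim
    using is_qmatroid_direct_sum_uniform_one eq G by (intro conjI exI[of _ 2] bexI[of _ G]) simp_all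
qed

end

theorem theorem4p4:
  fixes \<iota> :: "'a::{field,finite} \<Rightarrow> 'b::{field,finite}"
    and q m n\<^sub>1 n\<^sub>2 :: nat
  assumes "primepow q" and "m > 0" and "n\<^sub>1 \<ge> 2" and "n\<^sub>2 \<ge> 2"
    and "CARD('a) = q" and "CARD('b) = q ^ m" and "field_hom \<iota>"
    and "(even m \<and> m \<ge> 2 * max n\<^sub>1 n\<^sub>2)
       \<or> m \<ge> n\<^sub>1 * n\<^sub>2
       \<or> (\<exists>t\<^sub>1 t\<^sub>2 :: nat. t\<^sub>1 > 0 \<and> t\<^sub>2 > 0 \<and> m = t\<^sub>1 * t\<^sub>2 \<and> t\<^sub>1 \<ge> n\<^sub>1 \<and>
            real n\<^sub>2 \<le> real t\<^sub>1 * (real t\<^sub>2 - 1) / 2 + 1)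
       \<or> (\<exists>t\<^sub>1 t\<^sub>2 :: nat. t\<^sub>1 > 0 \<and> t\<^sub>2 > 0 \<and> m = t\<^sub>1 * t\<^sub>2 \<and> t\<^sub>1 \<ge> n\<^sub>1 \<and> t\<^sub>1 \<ge> n\<^sub>2 \<and> t\<^sub>2 \<ge> 2)
       \<or> (\<exists>p h r :: nat. prime p \<and> h > 0 \<and> r > 0 \<and> q = p ^ h \<and> m = p ^ r \<and>
            real n\<^sub>1 + real n\<^sub>2 - 1 \<le> real m / 2)"
  shows "representable_via \<iota>
           (qm_direct_sum (uniform_qmatroid 1 n\<^sub>1) (uniform_qmatroid 1 n\<^sub>2))"
proof -
  interpret field_hom \<iota> by fact
  interpret finite_field_extension \<iota> q m
    by unfold_locales fact+
  show ?thesis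
    using representable_if_ratio_disjoint_dims[OF ratio_disjoint_dims_exist] assms(3,4,8) by simp
qed

end
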